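(* Let $\Omega$ be a domain in $\mathbb{R}^{m+n}$, $m,n\geq 2$. Let $u:\Omega\to\mathbb{R}$ be such that (a) for each $y\in\mathbb{R}^n$ the function $\Omega(y)\ni x\mapsto u(x,y)\in\mathbb{R}$ is nearly subharmonic, and, for almost every $y\in\mathbb{R}^n$, subharmonic, (b) for each $x\in\mathbb{R}^m$ the function $\Omega(x)\ni y\mapsto u(x,y)\in\mathbb{R}$ is harmonic, (c) there is a nonnegative function $\varphi\in\mathcal{L}^1_{\mathrm{loc}}(\Omega)$ such that $-\varphi\leq u$. Then $u$ is subharmonic in $\Omega$.
   Context: Points of $\mathbb{R}^{m+n}$ are written $(x,y)$ with $x\in\mathbb{R}^m$, $y\in\mathbb{R}^n$. For $\Omega\subset\mathbb{R}^{m+n}$ put $\Omega(y)=\{x\in\mathbb{R}^m:(x,y)\in\Omega\}$ and $\Omega(x)=\{y\in\mathbb{R}^n:(x,y)\in\Omega\}$ (open, possibly empty or disconnected; definitions below are applied verbatim on them). $m_N$ is Lebesgue measure on $\mathbb{R}^N$, $B^N(x,r)$ the open ball, $\nu_N=m_N(B^N(0,1))$, and $u^+=\max\{u,0\}$. Let $D\subset\mathbb{R}^N$ be open, $N\ge2$. An upper semicontinuous $u:D\to[-\infty,+\infty)$ is subharmonic if $u(x)\leq\frac{1}{\nu_N r^N}\int_{B^N(x,r)}u\,dm_N$ for all closed balls $\overline{B^N(x,r)}\subset D$. A function $u:D\to[-\infty,+\infty)$ is nearly subharmonic if it is Lebesgue measurable, $u^+\in\mathcal{L}^1_{\mathrm{loc}}(D)$,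 and the same mean value inequality holds for all $\overline{B^N(x,r)}\subset D$. *)

theory Defs
  imports "HOL-Analysis.Analysis"
begin

text \<open>
  The predicates below are meant for open sets \<open>D\<close>, which may be empty or disconnected.
  Functions are total; only their values on \<open>D\<close> matter.
\<close>

text \<open>\<open>e2ennreal\<close> sends negative values to 0, so this is the integral of the positive part minus
  the integral of the negative part. It is the usual extended integral when the former is finite,
  which holds wherever it is used below; in the case \<open>\<infinity> - \<infinity>\<close> it would be \<open>\<infinity>\<close>.\<close>

definition ereal_integral_on :: "'a::euclidean_space set \<Rightarrow> ('a \<Rightarrow> ereal) \<Rightarrow> ereal" where
  "ereal_integral_on S f =
     enn2ereal (\<integral>\<^sup>+x\<in>S. e2ennreal (f x) \<partial>lebesgue) -
     enn2ereal (\<integral>\<^sup>+x\<in>S. e2ennreal (- f x) \<partial>lebesgue)"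

definition ball_average :: "('a::euclidean_space \<Rightarrow> ereal) \<Rightarrow> 'a \<Rightarrow> real \<Rightarrow> ereal" where
  "ball_average f x r =
     ereal (1 / (measure lebesgue (ball (0::'a) 1) * r ^ DIM('a))) * ereal_integral_on (ball x r) f"

definition submean_on :: "'a::euclidean_space set \<Rightarrow> ('a \<Rightarrow> ereal) \<Rightarrow> bool" where
  "submean_on D u \<longleftrightarrow> (\<forall>x r. 0 < r \<longrightarrow> cball x r \<subseteq> D \<longrightarrow> u x \<le> ball_average u x r)"

definition usc_on :: "'a::topological_space set \<Rightarrow> ('a \<Rightarrow> ereal) \<Rightarrow> bool" where
  "usc_on D u \<longleftrightarrow> (\<forall>a. openin (top_of_set D) {x \<in> D. u x < a})"

definition L1_loc :: "'a::euclidean_space set \<Rightarrow> ('a \<Rightarrow> real) \<Rightarrow> bool" where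
  "L1_loc D f \<longleftrightarrow> f \<in> borel_measurable (lebesgue_on D) \<and>
     (\<forall>K. compact K \<longrightarrow> K \<subseteq> D \<longrightarrow> f absolutely_integrable_on K)"

definition subharmonic_on :: "'a::euclidean_space set \<Rightarrow> ('a \<Rightarrow> ereal) \<Rightarrow> bool" where
  "subharmonic_on D u \<longleftrightarrow> (\<forall>x\<in>D. u x < \<infinity>) \<and> usc_on D u \<and> submean_on D u"

definition nearly_subharmonic_on :: "'a::euclidean_space set \<Rightarrow> ('a \<Rightarrow> ereal) \<Rightarrow> bool" where
  "nearly_subharmonic_on D u \<longleftrightarrow> (\<forall>x\<in>D. u x < \<infinity>) \<and>
     u \<in> borel_measurable (lebesgue_on D) \<and>
     L1_loc D (\<lambda>x. real_of_ereal (max (u x) 0)) \<and>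
     submean_on D u"

text \<open>Twice continuously differentiable (gradient \<open>G\<close>, second derivative \<open>H\<close>) with vanishing
  Laplacian, i.e. vanishing trace of \<open>H\<close>.\<close>

definition harmonic_on :: "'a::euclidean_space set \<Rightarrow> ('a \<Rightarrow> real) \<Rightarrow> bool" where
  "harmonic_on D f \<longleftrightarrow> (\<exists>(G :: 'a \<Rightarrow> 'a) (H :: 'a \<Rightarrow> 'a \<Rightarrow> 'a).
     (\<forall>x\<in>D. (f has_derivative (\<lambda>h. G x \<bullet> h)) (at x)) \<and>
     (\<forall>x\<in>D. (G has_derivative H x) (at x)) \<and>
     (\<forall>h. continuous_on D (\<lambda>x. H x h)) \<and>
     (\<forall>x\<in>D. (\<Sum>b\<in>Basis. H x b \<bullet> b) = 0))"

end

theory Submission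
  imports Defs
begin

text \<open>
  The function \<open>u\<close> is nearly subharmonic in \<open>x\<close> for every \<open>y\<close>, subharmonic in \<open>x\<close> for almost every
  \<open>y\<close>, harmonic in \<open>y\<close> for every \<open>x\<close>, and bounded below by a function \<open>- \<phi>\<close> that is locally
  integrable. The only potential theory needed is the volume mean value property of harmonic
  functions (\<open>harmonic_on_imp_mean_value\<close>) and the Harnack inequality that follows from it: if
  \<open>h \<ge> 0\<close> is harmonic near \<open>cball z (\<rho> + d)\<close> and \<open>dist y z \<le> d\<close>, then \<open>ball y \<rho>\<close> lies in
  \<open>ball z (\<rho> + d)\<close>, so comparing the two integrals of \<open>h\<close> bounds \<open>h y\<close> by
  \<open>((\<rho> + d) / \<rho>) ^ n * h z\<close>.

  \<^emph>\<open>Local upper bounds.\<close> Near \<open>(x0, y0)\<close> let \<open>a x\<close> be a suitable multiple of the integral of \<open>\<phi>\<close>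
  over the slice at \<open>x\<close>; it is an integrable function of \<open>x\<close>. By the mean value property in
  \<open>y\<close>, \<open>u (x, y) + a x \<ge> 0\<close>, and Harnack yields \<open>u (x, y) \<le> 2 ^ n * (max 0 (u (x, y0)) + a x)\<close>. The right
  side does not depend on \<open>y\<close> and is integrable in \<open>x\<close>, hence the submean inequality in \<open>x\<close> for
  each \<open>y\<close> bounds \<open>u\<close> above near \<open>(x0, y0)\<close>.

  \<^emph>\<open>Upper semicontinuity.\<close> If \<open>u \<le> M\<close> near \<open>(x0, y0)\<close>, then \<open>M - u (x, y)\<close> is nonnegative and harmonic in
  \<open>y\<close>, and Harnack with a constant close to \<open>1\<close> allows \<open>y\<close> and \<open>y0\<close> to be replaced by a nearby \<open>y1\<close>
  for which \<open>u (x, y1)\<close> is upper semicontinuous in \<open>x\<close>; almost every \<open>y1\<close> will do.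

  \<^emph>\<open>Submean inequality.\<close> Each slice of a ball about \<open>(x0, y0)\<close> in a coordinate direction is a ball
  about \<open>y0\<close>, respectively \<open>x0\<close>. By the mean value property in \<open>y\<close>, the integral of
  \<open>M - u (x, y)\<close> over the ball equals that of \<open>M - u (x, y0)\<close>; in the other order of integration
  the submean inequality for \<open>u (x, y0)\<close> in \<open>x\<close> bounds it by the integral of the constant
  \<open>M - u (x0, y0)\<close>.
\<close>

section \<open>Differentiation under the integral and integration by parts on balls\<close>

lemma integrable_indicator_mult_continuous:
  fixes f :: "'a::euclidean_space \<Rightarrow> real"
  assumes "continuous_on (ball c r) f" "\<And>y. y \<in> ball c r \<Longrightarrow> \<bar>f y\<bar> \<le> M"
  shows "integrable lborel (\<lambda>y. indicator (ball c r) y * f y)"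
proof (rule Bochner_Integration.integrable_bound)
  show "integrable lborel (\<lambda>y. indicator (ball c r) y * M)"
    using emeasure_lborel_ball_finite[of c r] by (intro integrable_mult_left) auto
  show "(\<lambda>y. indicator (ball c r) y * f y) \<in> borel_measurable lborel"
    using borel_measurable_continuous_on_indicator[OF _ assms(1)] by simp
  show "AE y in lborel. norm (indicator (ball c r) y * f y) \<le> norm (indicator (ball c r) y * M)"
    using assms(2) by (intro AE_I2) (force simp: indicator_def)
qed

text \<open>Differentiation under the integral sign at the parameter value \<open>0\<close>, by dominated convergence of the
  difference quotients.\<close>

lemma has_real_derivative_lborel_integral:
  fixes F :: "real \<Rightarrow> 'a::euclidean_space \<Rightarrow> real"
  assumes "0 < \<delta>" and S: "S \<in> sets borel" "emeasure lborel S < \<infinity>"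
    and int: "\<And>s. \<bar>s\<bar> < \<delta> \<Longrightarrow> integrable lborel (F s)"
    and lip: "\<And>s y. \<bar>s\<bar> < \<delta> \<Longrightarrow> \<bar>F s y - F 0 y\<bar> \<le> L * \<bar>s\<bar> * indicator S y"
    and der: "AE y in lborel. ((\<lambda>s. F s y) has_real_derivative F' y) (at 0)"
    and F': "F' \<in> borel_measurable borel"
  shows "((\<lambda>s. \<integral>y. F s y \<partial>lborel) has_real_derivative (\<integral>y. F' y \<partial>lborel)) (at 0)"
  unfolding DERIV_def tendsto_at_iff_sequentially
proof (intro allI impI)
  fix X :: "nat \<Rightarrow> real" assume X: "\<forall>i. X i \<in> UNIV - {0}" "X \<longlonglongrightarrow> 0"
  obtain N where N: "\<And>i. i \<ge> N \<Longrightarrow> \<bar>X i\<bar> < \<delta>"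
    using X(2) \<open>0 < \<delta>\<close> unfolding LIMSEQ_iff by fastforce
  define Y where "Y i = X (i + N)" for i
  have Y: "\<bar>Y i\<bar> < \<delta>" "Y i \<noteq> 0" for i using N X by (auto simp: Y_def)
  have Y0: "Y \<longlonglongrightarrow> 0" unfolding Y_def using X(2) by (rule LIMSEQ_ignore_initial_segment)
  have int0: "integrable lborel (F 0)" using int[of 0] \<open>0 < \<delta>\<close> by simp
  have "(\<lambda>i. \<integral>y. (F (Y i) y - F 0 y) / Y i \<partial>lborel) \<longlonglongrightarrow> (\<integral>y. F' y \<partial>lborel)"
  proof (rule integral_dominated_convergence)
    show "integrable lborel (\<lambda>y. L * indicator S y :: real)" using S by auto
    show "AE y in lborel. (\<lambda>i. (F (Y i) y - F 0 y) / Y i) \<longlonglongrightarrow> F' y"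
      using der
    proof eventually_elim
      case (elim y)
      then have "((\<lambda>h. (F h y - F 0 y) / h) \<longlongrightarrow> F' y) (at 0)"
        by (simp add: DERIV_def)
      then show ?case
        unfolding tendsto_at_iff_sequentially using Y Y0 by (fastforce simp: o_def)
    qed
    show "(\<lambda>y. (F (Y i) y - F 0 y) / Y i) \<in> borel_measurable lborel" for i
      using int[OF Y(1)] int0 by auto
    show "AE y in lborel. norm ((F (Y i) y - F 0 y) / Y i) \<le> L * indicator S y" for i
      using lip[OF Y(1), of i] Y(2)[of i] by (intro AE_I2) (simp add: field_simps)
  qed (use F' in simp)
  also have "(\<lambda>i. \<integral>y. (F (Y i) y - F 0 y) / Y i \<partial>lborel)
      = (\<lambda>i. ((\<integral>y. F (Y i) y \<partial>lborel) - (\<integral>y. F 0 y \<partial>lborel)) / Y i)"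
    using int[OF Y(1)] int0 by simp
  finally show "((\<lambda>h. ((\<integral>y. F (0 + h) y \<partial>lborel) - (\<integral>y. F 0 y \<partial>lborel)) / h) \<circ> X)
      \<longlonglongrightarrow> (\<integral>y. F' y \<partial>lborel)"
    by (auto simp: Y_def o_def intro: LIMSEQ_offset[where k = N])
qed

lemma integrable_lborel_translate:
  fixes f :: "'a::euclidean_space \<Rightarrow> real"
  assumes "integrable lborel f"
  shows "integrable lborel (\<lambda>y. f (c + y))" "(\<integral>y. f (c + y) \<partial>lborel) = (\<integral>y. f y \<partial>lborel)"
proof -
  have *: "(+) c \<in> lborel \<rightarrow>\<^sub>M borel" by simp
  have f: "f \<in> borel_measurable borel" using assms by auto
  show "integrable lborel (\<lambda>y. f (c + y))"
    using integrable_distr_eq[OF * f] assms by (simp add: lborel_distr_plus)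
  show "(\<integral>y. f (c + y) \<partial>lborel) = (\<integral>y. f y \<partial>lborel)"
    using integral_distr[OF * f] by (simp add: lborel_distr_plus)
qed

text \<open>The translates of \<open>V\<close> all have the same integral, so the derivative of that integral in the
  direction \<open>e\<close> vanishes. This replaces the divergence theorem below.\<close>

lemma integral_directional_derivative_eq_0:
  fixes V :: "'a::euclidean_space \<Rightarrow> real"
  assumes V: "integrable lborel V"
    and lip: "\<And>y z. \<bar>V y - V z\<bar> \<le> L * dist y z" and L: "0 \<le> L"
    and supp: "\<And>y. y \<notin> ball 0 R \<Longrightarrow> V y = 0"
    and der: "AE y in lborel. ((\<lambda>s. V (y + s *\<^sub>R e)) has_real_derivative V' y) (at 0)"
    and V': "V' \<in> borel_measurable borel"
  shows "(\<integral>y. V' y \<partial>lborel) = 0"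
proof -
  let ?F = "\<lambda>s y. V (y + s *\<^sub>R e)"
  have 1: "((\<lambda>s. \<integral>y. ?F s y \<partial>lborel) has_real_derivative (\<integral>y. V' y \<partial>lborel)) (at 0)"
  proof (rule has_real_derivative_lborel_integral[where S = "ball 0 (R + norm e)" and \<delta> = 1 and L = "L * norm e"])
    show "integrable lborel (?F s)" for s
      using integrable_lborel_translate(1)[OF V, of "s *\<^sub>R e"] by (simp add: add.commute)
    fix s :: real and y assume s: "\<bar>s\<bar> < 1"
    show "\<bar>?F s y - ?F 0 y\<bar> \<le> L * norm e * \<bar>s\<bar> * indicator (ball 0 (R + norm e)) y"
    proof (cases "y \<in> ball 0 (R + norm e)")
      case True
      then show ?thesis using lip[of "y + s *\<^sub>R e" y] by (simp add: dist_norm mult_ac)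
    next
      case False
      have "norm (s *\<^sub>R e) \<le> norm e" using s by (simp add: mult_left_le_one_le)
      with False norm_diff_ineq[of y "s *\<^sub>R e"] have "y + s *\<^sub>R e \<notin> ball 0 R" "y \<notin> ball 0 R"
        using norm_ge_zero[of e] by (auto simp: not_less simp del: norm_scaleR norm_ge_zero)
      with False supp show ?thesis by simp
    qed
  qed (use der V' emeasure_lborel_ball_finite in auto)
  have "(\<integral>y. ?F s y \<partial>lborel) = (\<integral>y. V y \<partial>lborel)" for s
    using integrable_lborel_translate(2)[OF V, of "s *\<^sub>R e"] by (simp add: add.commute)
  with 1 have "((\<lambda>s. \<integral>y. V y \<partial>lborel) has_real_derivative (\<integral>y. V' y \<partial>lborel)) (at (0::real))"
    by simp
  then show ?thesis using DERIV_unique[OF _ DERIV_const] by blast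
qed

text \<open>Integration by parts on a ball for the product of \<open>g\<close> with the weight \<open>(r\<^sup>2 - (norm y)\<^sup>2) / 2\<close>. The weight
  vanishes on the sphere, so the product extends by zero to a Lipschitz function on the whole space,
  and no boundary term appears; the derivative of the weight in the direction \<open>e\<close> is \<open>- (y \<bullet> e)\<close>.\<close>

lemma integral_ball_parts:
  fixes g g' :: "'a::euclidean_space \<Rightarrow> real"
  assumes "0 < r"
    and lip: "\<And>y z. y \<in> ball 0 r \<Longrightarrow> z \<in> ball 0 r \<Longrightarrow> \<bar>g y - g z\<bar> \<le> B * dist y z"
    and bd: "\<And>y. y \<in> ball 0 r \<Longrightarrow> \<bar>g y\<bar> \<le> M"
    and der: "\<And>y. y \<in> ball 0 r \<Longrightarrow> ((\<lambda>s. g (y + s *\<^sub>R e)) has_real_derivative g' y) (at 0)"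
    and cont: "continuous_on (ball 0 r) g'"
  shows "(\<integral>y. indicator (ball 0 r) y * ((r\<^sup>2 - (norm y)\<^sup>2) / 2 * g' y - (y \<bullet> e) * g y) \<partial>lborel) = 0"
proof -
  define w where "w y = (r\<^sup>2 - (norm y)\<^sup>2) / 2" for y :: 'a
  define V where "V y = indicator (ball 0 r) y * (w y * g y)" for y
  have "B \<ge> 0"
  proof -
    obtain e :: 'a where e: "norm e = r / 2" using \<open>0 < r\<close> vector_choose_size[of "r/2"] by auto
    with lip[of e 0] \<open>0 < r\<close> have "0 \<le> B * (r / 2)" by auto
    with \<open>0 < r\<close> show ?thesis by (simp add: zero_le_mult_iff)
  qed
  have "M \<ge> 0" using bd[of 0] \<open>0 < r\<close> by auto
  have g_cont: "continuous_on (ball 0 r) g"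
    using lip \<open>B \<ge> 0\<close> by (intro lipschitz_on_continuous_on[of B] lipschitz_onI) (auto simp: dist_real_def)
  have w_cont: "continuous_on S w" for S unfolding w_def by (intro continuous_intros) auto
  have w_lip: "\<bar>w y - w z\<bar> \<le> r * dist y z" if "norm y \<le> r" "norm z \<le> r" for y z
  proof -
    have "w y - w z = (norm z - norm y) * (norm y + norm z) / 2"
      by (simp add: w_def power2_eq_square algebra_simps diff_divide_distrib)
    then have "\<bar>w y - w z\<bar> = \<bar>norm y - norm z\<bar> * (norm y + norm z) / 2"
      by (simp only: abs_mult abs_divide) (simp add: abs_minus_commute)
    also have "\<dots> \<le> dist y z * (2 * r) / 2"
      using that norm_triangle_ineq3[of y z] by (intro divide_right_mono mult_mono) (auto simp: dist_norm)
    finally show ?thesis by (simp add: mult.commute)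
  qed
  have w_bd: "0 \<le> w y" "w y \<le> r\<^sup>2 / 2" if "norm y \<le> r" for y
    using that by (auto simp: w_def power_mono)
  define L where "L = r * M + r\<^sup>2 / 2 * B"
  have "L \<ge> 0" using \<open>0 < r\<close> \<open>M \<ge> 0\<close> \<open>B \<ge> 0\<close> by (simp add: L_def)
  have V_out: "\<bar>V y - V z\<bar> \<le> L * dist y z" if "y \<in> ball 0 r" "z \<notin> ball 0 r" for y z
  proof -
    have "\<bar>V y\<bar> = w y * \<bar>g y\<bar>" using that w_bd(1)[of y] by (auto simp: V_def abs_mult)
    also have "\<dots> \<le> w y * M" using bd that w_bd(1)[of y] by (intro mult_left_mono) auto
    also have "w y = (r - norm y) * (r + norm y) / 2" by (simp add: w_def power2_eq_square algebra_simps)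
    also have "\<dots> \<le> dist y z * (2 * r) / 2"
      using that norm_triangle_ineq3[of y z] \<open>0 < r\<close>
      by (intro divide_right_mono mult_mono) (auto simp: dist_norm)
    finally have "\<bar>V y\<bar> \<le> r * M * dist y z" using \<open>M \<ge> 0\<close> by (simp add: mult_right_mono mult_ac)
    also have "\<dots> \<le> L * dist y z" using \<open>B \<ge> 0\<close> by (auto simp: L_def intro!: mult_right_mono)
    finally show ?thesis using that by (simp add: V_def)
  qed
  have V_in: "\<bar>V y - V z\<bar> \<le> L * dist y z" if "y \<in> ball 0 r" "z \<in> ball 0 r" for y z
  proof -
    have "V y - V z = (w y - w z) * g y + w z * (g y - g z)"
      using that by (simp add: V_def algebra_simps)
    also have "\<bar>\<dots>\<bar> \<le> \<bar>w y - w z\<bar> * \<bar>g y\<bar> + \<bar>w z\<bar> * \<bar>g y - g z\<bar>"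
      by (simp add: abs_mult[symmetric])
    also have "\<dots> \<le> (r * dist y z) * M + r\<^sup>2 / 2 * (B * dist y z)"
      using that w_lip[of y z] w_bd[of z] bd[of y] lip[of y z] \<open>0 < r\<close>
      by (intro add_mono mult_mono) auto
    finally show ?thesis by (simp add: L_def algebra_simps)
  qed
  have V_lip: "\<bar>V y - V z\<bar> \<le> L * dist y z" for y z
  proof -
    consider "y \<in> ball 0 r" "z \<in> ball 0 r" | "y \<in> ball 0 r" "z \<notin> ball 0 r"
      | "y \<notin> ball 0 r" "z \<in> ball 0 r" | "y \<notin> ball 0 r" "z \<notin> ball 0 r" by blast
    then show ?thesis
    proof cases
      case 3 then show ?thesis using V_out[of z y] by (simp add: dist_commute abs_minus_commute)
    next
      case 4 then show ?thesis using \<open>L \<ge> 0\<close> by (simp add: V_def)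
    qed (use V_in V_out in auto)
  qed
  have V_int: "integrable lborel V"
    unfolding V_def
  proof (rule integrable_indicator_mult_continuous)
    show "continuous_on (ball 0 r) (\<lambda>y. w y * g y)" by (intro continuous_intros w_cont g_cont)
    show "\<bar>w y * g y\<bar> \<le> r\<^sup>2 / 2 * M" if "y \<in> ball 0 r" for y
      unfolding abs_mult using that w_bd[of y] bd[of y] by (intro mult_mono) auto
  qed
  have "(\<integral>y. indicator (ball 0 r) y * (w y * g' y - (y \<bullet> e) * g y) \<partial>lborel) = 0"
  proof (rule integral_directional_derivative_eq_0[OF V_int V_lip \<open>L \<ge> 0\<close>, where R = r and e = e])
    show "(\<lambda>y. indicator (ball 0 r) y * (w y * g' y - (y \<bullet> e) * g y)) \<in> borel_measurable borel"
      using borel_measurable_continuous_on_indicator[of "ball 0 r" "\<lambda>y. w y * g' y - (y \<bullet> e) * g y"]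
      by (simp add: continuous_intros w_cont g_cont cont)
    have "AE y :: 'a in lborel. y \<notin> sphere 0 r"
      using negligible_sphere[of "0::'a" r] 
      by (intro AE_not_in) (simp add: negligible_iff_null_sets null_sets_completion_iff)
    then show "AE y in lborel. ((\<lambda>s. V (y + s *\<^sub>R e)) has_real_derivative
        indicator (ball 0 r) y * (w y * g' y - (y \<bullet> e) * g y)) (at 0)"
    proof eventually_elim
      case (elim y)
      have lim: "((\<lambda>s. y + s *\<^sub>R e) \<longlongrightarrow> y) (nhds 0)"
        by (auto intro!: tendsto_eq_intros filterlim_ident)
      show ?case
      proof (cases "y \<in> ball 0 r")
        case True
        have ev: "eventually (\<lambda>s. y + s *\<^sub>R e \<in> ball 0 r) (nhds 0)"
          using topological_tendstoD[OF lim open_ball[of 0 r]] True by simp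
        have "((\<lambda>s. w (y + s *\<^sub>R e)) has_real_derivative - (y \<bullet> e)) (at 0)"
          unfolding w_def power2_norm_eq_inner
          by (auto intro!: derivative_eq_intros simp: inner_commute inner_add)
        from DERIV_mult[OF this der[OF True]]
        have "((\<lambda>s. w (y + s *\<^sub>R e) * g (y + s *\<^sub>R e)) has_real_derivative
          (w y * g' y - (y \<bullet> e) * g y)) (at 0)" by (simp add: algebra_simps)
        then have "((\<lambda>s. V (y + s *\<^sub>R e)) has_real_derivative (w y * g' y - (y \<bullet> e) * g y)) (at 0)"
          by (rule DERIV_cong_ev[THEN iffD2, rotated -1])
             (auto simp: V_def intro: eventually_mono[OF ev])
        then show ?thesis using True by simp
      next
        case False
        with elim have "y \<in> - cball 0 r" by auto
        from topological_tendstoD[OF lim _ this]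
        have ev: "eventually (\<lambda>s. y + s *\<^sub>R e \<in> - cball 0 r) (nhds 0)" by auto
        have "((\<lambda>s. V (y + s *\<^sub>R e)) has_real_derivative 0) (at 0)"
          by (rule DERIV_cong_ev[THEN iffD2, rotated -1, OF DERIV_const[of 0]])
             (auto simp: V_def intro: eventually_mono[OF ev])
        then show ?thesis using False by simp
      qed
    qed
  qed (simp add: V_def)
  then show ?thesis by (simp add: w_def)
qed

section \<open>The mean value property of harmonic functions\<close>

lemma integrable_indicator_ball_continuous:
  fixes f :: "'a::euclidean_space \<Rightarrow> real"
  assumes "continuous_on (cball c r) f"
  shows "integrable lborel (\<lambda>y. indicator (ball c r) y * f y)"
proof -
  obtain M where M: "\<And>y. y \<in> cball c r \<Longrightarrow> \<bar>f y\<bar> \<le> M"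
    using compact_imp_bounded[OF compact_continuous_image[OF assms compact_cball]]
    by (force simp: bounded_iff)
  show ?thesis
    by (rule integrable_indicator_mult_continuous[where M = M])
       (use M in \<open>auto intro: continuous_on_subset[OF assms]\<close>)
qed

lemma cball_subset_open_imp_larger_cball_subset:
  fixes x :: "'a::euclidean_space"
  assumes "open D" "0 < r" "cball x r \<subseteq> D"
  obtains \<epsilon> where "0 < \<epsilon>" "cball x (r + \<epsilon>) \<subseteq> D"
proof -
  obtain \<epsilon> where \<epsilon>: "\<epsilon> > 0" "(\<Union>z\<in>cball x r. cball z \<epsilon>) \<subseteq> D"
    using compact_subset_open_imp_cball_epsilon_subset[OF compact_cball assms(1,3)] by blast
  have "z \<in> D" if z: "z \<in> cball x (r + \<epsilon>)" for z
  proof (cases "dist x z \<le> r")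
    case True then show ?thesis using assms(3) by auto
  next
    case False
    define p where "p = x + (r / dist x z) *\<^sub>R (z - x)"
    have "p \<in> cball x r" using False \<open>0 < r\<close> by (simp add: p_def dist_norm norm_minus_commute)
    have zp: "z - p = (1 - r / dist x z) *\<^sub>R (z - x)" by (simp add: p_def algebra_simps)
    have "dist p z = \<bar>1 - r / dist x z\<bar> * dist x z"
      using arg_cong[OF zp, of norm] by (simp add: dist_norm norm_minus_commute)
    moreover have "dist x z > r" "dist x z > 0" using False \<open>0 < r\<close> by linarith+
    moreover then have "r / dist x z < 1" by (simp add: divide_less_eq)
    ultimately have "dist p z = dist x z - r" by (simp add: left_diff_distrib)
    then have "z \<in> cball p \<epsilon>" using z by simp
    with \<open>p \<in> cball x r\<close> show ?thesis using \<epsilon>(2) by blast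
  qed
  with \<epsilon>(1) that show ?thesis by blast
qed

text \<open>Let \<open>A t\<close> be the integral of \<open>f (x + t y)\<close> over \<open>y \<in> ball 0 r\<close>. Its derivative is the integral of
  \<open>y \<bullet> G (x + t y)\<close> with \<open>G\<close> the gradient of \<open>f\<close>. Integration by parts in each
  coordinate turns this into a weighted integral of the Laplacian, which is zero. Hence \<open>A 1 = A 0\<close>.\<close>

lemma harmonic_on_imp_mean_value:
  fixes f :: "'a::euclidean_space \<Rightarrow> real"
  assumes "harmonic_on D f" "open D" "0 < r" "cball x r \<subseteq> D"
  shows "integrable lborel (\<lambda>y. indicator (ball x r) y * f y)"
    and "(\<integral>y. indicator (ball x r) y * f y \<partial>lborel) = measure lborel (ball x r) * f x"
proof -
  obtain G :: "'a \<Rightarrow> 'a" and H :: "'a \<Rightarrow> 'a \<Rightarrow> 'a" where GH: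
    "(\<forall>z\<in>D. (f has_derivative (\<lambda>h. G z \<bullet> h)) (at z)) \<and>
     (\<forall>z\<in>D. (G has_derivative H z) (at z)) \<and>
     (\<forall>h. continuous_on D (\<lambda>z. H z h)) \<and>
     (\<forall>z\<in>D. (\<Sum>b\<in>Basis. H z b \<bullet> b) = 0)"
    using assms(1) unfolding harmonic_on_def by (elim exE)
  have f': "\<And>z. z \<in> D \<Longrightarrow> (f has_derivative (\<lambda>h. G z \<bullet> h)) (at z)"
    and G': "\<And>z. z \<in> D \<Longrightarrow> (G has_derivative H z) (at z)"
    and H_cont: "\<And>h. continuous_on D (\<lambda>z. H z h)"
    and laplace: "\<And>z. z \<in> D \<Longrightarrow> (\<Sum>b\<in>Basis. H z b \<bullet> b) = 0"
    using GH by auto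
  obtain \<epsilon> where "0 < \<epsilon>" and KD: "cball x (r + \<epsilon>) \<subseteq> D"
    using cball_subset_open_imp_larger_cball_subset[OF assms(2-4)] .
  define K where "K = cball x (r + \<epsilon>)"
  have KD: "K \<subseteq> D" and K: "compact K" "convex K" using KD by (auto simp: K_def)
  have f_cont: "continuous_on D f" and G_cont: "continuous_on D G"
    using f' G' has_derivative_continuous by (blast intro: continuous_at_imp_continuous_on)+
  have bound: "\<exists>M\<ge>0. \<forall>z\<in>K. norm (k z) \<le> M" if "continuous_on D k" for k :: "'a \<Rightarrow> 'a"
    using compact_imp_bounded[OF compact_continuous_image[OF continuous_on_subset[OF that KD] K(1)]]
    unfolding bounded_pos by (meson image_eqI less_imp_le)
  obtain M where M: "M \<ge> 0" "\<And>z. z \<in> K \<Longrightarrow> norm (G z) \<le> M" using bound[OF G_cont] by blast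
  obtain N where N: "\<And>b. N b \<ge> 0" "\<And>b z. z \<in> K \<Longrightarrow> norm (H z b) \<le> N b"
    using choice[of "\<lambda>b M. M \<ge> 0 \<and> (\<forall>z\<in>K. norm (H z b) \<le> M)"] bound[OF H_cont] by blast
  define B where "B = (\<Sum>b\<in>Basis. N b)"
  have H_lin: "bounded_linear (H z)" if "z \<in> K" for z
    using G' KD that has_derivative_bounded_linear by blast
  have H_bd: "onorm (H z) \<le> B" if "z \<in> K" for z
  proof (rule onorm_bound)
    show "0 \<le> B" using N(1) by (simp add: B_def sum_nonneg)
    fix h
    interpret bounded_linear "H z" using H_lin[OF that] .
    have "H z h = (\<Sum>b\<in>Basis. (h \<bullet> b) *\<^sub>R H z b)"
      by (subst euclidean_representation[of h, symmetric]) (simp add: sum scaleR)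
    also have "norm \<dots> \<le> (\<Sum>b\<in>Basis. norm h * N b)"
      using N that by (intro sum_norm_le) (auto intro!: mult_mono simp: Basis_le_norm)
    finally show "norm (H z h) \<le> B * norm h" by (simp add: B_def sum_distrib_left mult.commute)
  qed
  have f_lip: "\<bar>f y - f z\<bar> \<le> M * norm (y - z)" if "y \<in> K" "z \<in> K" for y z
  proof -
    have "norm (f y - f z) \<le> M * norm (y - z)"
    proof (rule differentiable_bound[OF K(2) _ _ that])
      fix w assume w: "w \<in> K"
      then show "(f has_derivative (\<lambda>h. G w \<bullet> h)) (at w within K)"
        using f' KD by (blast intro: has_derivative_at_withinI)
      show "onorm (\<lambda>h. G w \<bullet> h) \<le> M"
      proof (rule onorm_bound)
        fix h
        have "norm (G w \<bullet> h) \<le> norm (G w) * norm h" using Cauchy_Schwarz_ineq2[of "G w" h] by simp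
        also have "\<dots> \<le> M * norm h" using M(2)[OF w] by (intro mult_right_mono) auto
        finally show "norm (G w \<bullet> h) \<le> M * norm h" .
      qed (use M in auto)
    qed
    then show ?thesis by simp
  qed
  have G_lip: "norm (G y - G z) \<le> B * norm (y - z)" if "y \<in> K" "z \<in> K" for y z
    by (rule differentiable_bound[OF K(2) _ H_bd that])
       (use G' KD in \<open>blast intro: has_derivative_at_withinI\<close>)
  have dilate: "x + t *\<^sub>R y \<in> K" if "norm y \<le> r" "\<bar>t\<bar> \<le> 1 + \<epsilon> / r" for t y
  proof -
    have "\<bar>t\<bar> * norm y \<le> (1 + \<epsilon> / r) * r" using that \<open>0 < r\<close> by (intro mult_mono) auto
    also have "\<dots> = r + \<epsilon>" using \<open>0 < r\<close> by (simp add: field_simps)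
    finally show ?thesis by (simp add: K_def dist_norm)
  qed
  have unit_le: "\<bar>t\<bar> \<le> 1 + \<epsilon> / r" if "t \<in> {0..1}" for t
    using that divide_pos_pos[OF \<open>0 < \<epsilon>\<close> \<open>0 < r\<close>] by auto
  have dilate1: "x + t *\<^sub>R y \<in> K" if "norm y \<le> r" "t \<in> {0..1}" for t y
    using that dilate unit_le by blast
  have cont_dilate: "continuous_on (cball 0 r) (\<lambda>y. k (x + t *\<^sub>R y))"
    if "continuous_on D k" "\<bar>t\<bar> \<le> 1 + \<epsilon> / r" for k :: "'a \<Rightarrow> 'b::euclidean_space" and t
    using that dilate KD by (intro continuous_on_compose2[OF that(1)] continuous_intros) auto

  have G_moment: "(\<integral>y. indicator (ball 0 r) y * (y \<bullet> G (x + t *\<^sub>R y)) \<partial>lborel) = 0"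
    if t: "t \<in> {0..1}" for t
  proof -
    have t': "\<bar>t\<bar> \<le> 1 + \<epsilon> / r" using unit_le[OF t] .
    let ?I = "\<lambda>b y. (r\<^sup>2 - (norm y)\<^sup>2) / 2 * (t * (H (x + t *\<^sub>R y) b \<bullet> b)) - (y \<bullet> b) * (G (x + t *\<^sub>R y) \<bullet> b)"
    have cont: "continuous_on (cball 0 r) (\<lambda>y. t * (H (x + t *\<^sub>R y) b \<bullet> b))" for b
      by (intro continuous_intros cont_dilate[OF H_cont t'])
    have int: "integrable lborel (\<lambda>y. indicator (ball 0 r) y * ?I b y)" for b
      by (intro integrable_indicator_ball_continuous continuous_intros cont cont_dilate[OF G_cont t']) auto
    have zero: "(\<integral>y. indicator (ball 0 r) y * ?I b y \<partial>lborel) = 0" if b: "b \<in> Basis" for b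
    proof (rule integral_ball_parts[OF \<open>0 < r\<close>, where B = B and M = M])
      have "B \<ge> 0" using N(1) by (simp add: B_def sum_nonneg)
      fix y z :: 'a assume y: "y \<in> ball 0 r" and z: "z \<in> ball 0 r"
      have "\<bar>G (x + t *\<^sub>R y) \<bullet> b - G (x + t *\<^sub>R z) \<bullet> b\<bar> \<le> norm (G (x + t *\<^sub>R y) - G (x + t *\<^sub>R z))"
        using b Basis_le_norm by (simp flip: inner_diff_left)
      also have "\<dots> \<le> B * norm ((x + t *\<^sub>R y) - (x + t *\<^sub>R z))"
        using y z by (intro G_lip dilate1[OF _ t]) auto
      also have "(x + t *\<^sub>R y) - (x + t *\<^sub>R z) = t *\<^sub>R (y - z)" by (simp add: algebra_simps)
      also have "B * norm (t *\<^sub>R (y - z)) \<le> B * dist y z"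
        using t \<open>B \<ge> 0\<close> by (intro mult_left_mono) (auto simp: dist_norm mult_left_le_one_le)
      finally show "\<bar>G (x + t *\<^sub>R y) \<bullet> b - G (x + t *\<^sub>R z) \<bullet> b\<bar> \<le> B * dist y z" .
    next
      fix y :: 'a assume y: "y \<in> ball 0 r"
      then have yK: "x + t *\<^sub>R y \<in> K" using dilate1[OF _ t] by auto
      show "\<bar>G (x + t *\<^sub>R y) \<bullet> b\<bar> \<le> M"
        using Basis_le_norm[OF b] M(2)[OF yK] order_trans by blast
      have "((\<lambda>s. x + t *\<^sub>R (y + s *\<^sub>R b)) has_derivative (\<lambda>s. t *\<^sub>R (s *\<^sub>R b))) (at 0)"
        by (auto intro!: derivative_eq_intros)
      moreover have "(G has_derivative H (x + t *\<^sub>R y)) (at (x + t *\<^sub>R (y + 0 *\<^sub>R b)))"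
        using G' yK KD by auto
      ultimately have "((\<lambda>s. G (x + t *\<^sub>R (y + s *\<^sub>R b))) has_derivative
          (\<lambda>s. H (x + t *\<^sub>R y) (t *\<^sub>R (s *\<^sub>R b)))) (at 0)"
        by (rule has_derivative_compose)
      then have "((\<lambda>s. G (x + t *\<^sub>R (y + s *\<^sub>R b)) \<bullet> b) has_derivative
          (\<lambda>s. H (x + t *\<^sub>R y) (t *\<^sub>R (s *\<^sub>R b)) \<bullet> b)) (at 0)"
        by (rule has_derivative_inner_left)
      moreover have "(\<lambda>s. H (x + t *\<^sub>R y) (t *\<^sub>R (s *\<^sub>R b)) \<bullet> b) = (*) (t * (H (x + t *\<^sub>R y) b \<bullet> b))"
      proof
        fix s
        interpret bounded_linear "H (x + t *\<^sub>R y)" using H_lin[OF yK] .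
        show "H (x + t *\<^sub>R y) (t *\<^sub>R (s *\<^sub>R b)) \<bullet> b = t * (H (x + t *\<^sub>R y) b \<bullet> b) * s"
          by (simp add: scaleR)
      qed
      ultimately show "((\<lambda>s. G (x + t *\<^sub>R (y + s *\<^sub>R b)) \<bullet> b) has_real_derivative
          t * (H (x + t *\<^sub>R y) b \<bullet> b)) (at 0)"
        by (simp add: has_field_derivative_def)
    qed (rule continuous_on_subset[OF cont], auto)
    have "(\<integral>y. indicator (ball 0 r) y * (y \<bullet> G (x + t *\<^sub>R y)) \<partial>lborel)
      = (\<integral>y. - (\<Sum>b\<in>Basis. indicator (ball 0 r) y * ?I b y) \<partial>lborel)"
    proof (intro Bochner_Integration.integral_cong refl)
      fix y :: 'a
      show "indicator (ball 0 r) y * (y \<bullet> G (x + t *\<^sub>R y)) = - (\<Sum>b\<in>Basis. indicator (ball 0 r) y * ?I b y)"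
      proof (cases "y \<in> ball 0 r")
        case True
        then have "x + t *\<^sub>R y \<in> D" using dilate1[OF _ t] KD by auto
        have "(\<Sum>b\<in>Basis. ?I b y) = (r\<^sup>2 - (norm y)\<^sup>2) / 2 * (t * (\<Sum>b\<in>Basis. H (x + t *\<^sub>R y) b \<bullet> b))
            - (\<Sum>b\<in>Basis. (y \<bullet> b) * (G (x + t *\<^sub>R y) \<bullet> b))"
          by (simp only: sum_subtractf sum_distrib_left)
        also have "\<dots> = - (y \<bullet> G (x + t *\<^sub>R y))"
          using laplace[OF \<open>x + t *\<^sub>R y \<in> D\<close>] euclidean_inner[of y "G (x + t *\<^sub>R y)"] by simp
        finally show ?thesis using True by simp
      qed simp
    qed
    also have "\<dots> = - (\<Sum>b\<in>Basis. \<integral>y. indicator (ball 0 r) y * ?I b y \<partial>lborel)"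
      by (subst Bochner_Integration.integral_minus, subst Bochner_Integration.integral_sum) (use int in auto)
    also have "\<dots> = 0" using zero by simp
    finally show ?thesis .
  qed

  define A where "A t = (\<integral>y. indicator (ball 0 r) y * f (x + t *\<^sub>R y) \<partial>lborel)" for t
  have A': "(A has_real_derivative 0) (at t)" if t: "t \<in> {0..1}" for t
  proof -
    have t_le: "\<bar>t + s\<bar> \<le> 1 + \<epsilon> / r" if "\<bar>s\<bar> < \<epsilon> / r" for s using that t by auto
    have t': "\<bar>t\<bar> \<le> 1 + \<epsilon> / r" using unit_le[OF t] .
    have "((\<lambda>s. \<integral>y. indicator (ball 0 r) y * f (x + (t + s) *\<^sub>R y) \<partial>lborel) has_real_derivative
        (\<integral>y. indicator (ball 0 r) y * (y \<bullet> G (x + t *\<^sub>R y)) \<partial>lborel)) (at 0)"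
    proof (rule has_real_derivative_lborel_integral[where \<delta> = "\<epsilon> / r" and S = "ball 0 r" and L = "M * r"])
      show "integrable lborel (\<lambda>y. indicator (ball 0 r) y * f (x + (t + s) *\<^sub>R y))"
        if "\<bar>s\<bar> < \<epsilon> / r" for s
        by (intro integrable_indicator_ball_continuous cont_dilate[OF f_cont] t_le that)
      show "(\<lambda>y. indicator (ball 0 r) y * (y \<bullet> G (x + t *\<^sub>R y))) \<in> borel_measurable borel"
      proof -
        have "continuous_on (cball 0 r) (\<lambda>y. y \<bullet> G (x + t *\<^sub>R y))"
          by (intro continuous_intros cont_dilate[OF G_cont t'])
        from borel_measurable_integrable[OF integrable_indicator_ball_continuous[OF this]]
        show ?thesis by simp
      qed
      show "AE y in lborel. ((\<lambda>s. indicator (ball 0 r) y * f (x + (t + s) *\<^sub>R y)) has_real_derivative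
          indicator (ball 0 r) y * (y \<bullet> G (x + t *\<^sub>R y))) (at 0)"
      proof (intro AE_I2)
        fix y :: 'a
        show "((\<lambda>s. indicator (ball 0 r) y * f (x + (t + s) *\<^sub>R y)) has_real_derivative
          indicator (ball 0 r) y * (y \<bullet> G (x + t *\<^sub>R y))) (at 0)"
        proof (cases "y \<in> ball 0 r")
          case True
          then have yD: "x + t *\<^sub>R y \<in> D" using dilate1[OF _ t] KD by auto
          have "((\<lambda>s. x + (t + s) *\<^sub>R y) has_derivative (\<lambda>s. s *\<^sub>R y)) (at 0)"
            by (auto intro!: derivative_eq_intros)
          moreover have "(f has_derivative (\<lambda>h. G (x + t *\<^sub>R y) \<bullet> h)) (at (x + (t + 0) *\<^sub>R y))"
            using f'[OF yD] by simp
          ultimately have "((\<lambda>s. f (x + (t + s) *\<^sub>R y)) has_derivative (\<lambda>s. G (x + t *\<^sub>R y) \<bullet> (s *\<^sub>R y))) (at 0)"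
            by (rule has_derivative_compose)
          moreover have "(\<lambda>s. G (x + t *\<^sub>R y) \<bullet> (s *\<^sub>R y)) = (*) (y \<bullet> G (x + t *\<^sub>R y))"
            by (auto simp: inner_commute)
          ultimately show ?thesis using True by (simp add: has_field_derivative_def)
        qed simp
      qed
      fix s y assume s: "\<bar>s\<bar> < \<epsilon> / r"
      show "\<bar>indicator (ball 0 r) y * f (x + (t + s) *\<^sub>R y) - indicator (ball 0 r) y * f (x + (t + 0) *\<^sub>R y)\<bar>
          \<le> M * r * \<bar>s\<bar> * indicator (ball 0 r) y"
      proof (cases "y \<in> ball 0 r")
        case True
        have "\<bar>f (x + (t + s) *\<^sub>R y) - f (x + t *\<^sub>R y)\<bar> \<le> M * norm ((x + (t + s) *\<^sub>R y) - (x + t *\<^sub>R y))"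
          using True t_le[OF s] t' by (intro f_lip dilate) auto
        also have "(x + (t + s) *\<^sub>R y) - (x + t *\<^sub>R y) = s *\<^sub>R y" by (simp add: algebra_simps)
        also have "M * norm (s *\<^sub>R y) \<le> M * (\<bar>s\<bar> * r)"
          using True M(1) by (auto intro!: mult_left_mono)
        finally show ?thesis using True by (simp add: mult_ac)
      qed simp
    qed (use \<open>0 < \<epsilon>\<close> \<open>0 < r\<close> emeasure_lborel_ball_finite in auto)
    then have "((\<lambda>s. A (s + t)) has_real_derivative 0) (at 0)"
      using G_moment[OF t] by (simp add: A_def add.commute)
    then show ?thesis by (simp add: DERIV_shift[of A 0 0 t, symmetric])
  qed
  have "A 1 = A 0"
    by (rule DERIV_isconst_end[where f = A])
       (use A' in \<open>auto intro!: continuous_at_imp_continuous_on DERIV_isCont[OF A']\<close>)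
  show int: "integrable lborel (\<lambda>y. indicator (ball x r) y * f y)"
    using assms(4) f_cont by (auto intro: integrable_indicator_ball_continuous continuous_on_subset)
  have "A 1 = (\<integral>y. indicator (ball x r) y * f y \<partial>lborel)"
    unfolding A_def integrable_lborel_translate(2)[OF int, of x, symmetric]
    by (intro Bochner_Integration.integral_cong) (auto simp: indicator_def dist_norm)
  moreover have "A 0 = measure lborel (ball x r) * f x"
    using \<open>0 < r\<close> by (simp add: A_def content_ball_conv_unit_ball[of r x] content_ball_conv_unit_ball[of r 0])
  ultimately show "(\<integral>y. indicator (ball x r) y * f y \<partial>lborel) = measure lborel (ball x r) * f x"
    using \<open>A 1 = A 0\<close> by simp
qed

section \<open>Harnack's inequality\<close>

lemma harmonic_on_affine:
  assumes "harmonic_on D f"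
  shows "harmonic_on D (\<lambda>y. c * f y + a)"
proof -
  obtain G H where GH:
    "(\<forall>z\<in>D. (f has_derivative (\<lambda>h. G z \<bullet> h)) (at z)) \<and>
     (\<forall>z\<in>D. (G has_derivative H z) (at z)) \<and>
     (\<forall>h. continuous_on D (\<lambda>z. H z h)) \<and>
     (\<forall>z\<in>D. (\<Sum>b\<in>Basis. H z b \<bullet> b) = 0)"
    using assms unfolding harmonic_on_def by (elim exE)
  show ?thesis
    unfolding harmonic_on_def
  proof (intro exI[of _ "\<lambda>z. c *\<^sub>R G z"] exI[of _ "\<lambda>z h. c *\<^sub>R H z h"] conjI ballI allI)
    fix z assume z: "z \<in> D"
    with GH have f': "(f has_derivative (\<lambda>h. G z \<bullet> h)) (at z)" and G': "(G has_derivative H z) (at z)"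
      and lap: "(\<Sum>b\<in>Basis. H z b \<bullet> b) = 0" by auto
    show "((\<lambda>y. c * f y + a) has_derivative (\<lambda>h. (c *\<^sub>R G z) \<bullet> h)) (at z)"
      by (auto intro!: derivative_eq_intros f')
    show "((\<lambda>z. c *\<^sub>R G z) has_derivative (\<lambda>h. c *\<^sub>R H z h)) (at z)"
      by (rule has_derivative_scaleR_right[OF G'])
    show "(\<Sum>b\<in>Basis. (c *\<^sub>R H z b) \<bullet> b) = 0"
      using lap by (simp flip: sum_distrib_left)
  next
    fix h show "continuous_on D (\<lambda>z. c *\<^sub>R H z h)" using GH by (intro continuous_intros) auto
  qed
qed

lemma measure_lborel_ball_translate:
  "0 \<le> r \<Longrightarrow> measure lborel (ball (x :: 'a::euclidean_space) r) = measure lborel (ball (0 :: 'a) r)"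
  by (simp add: content_ball_conv_unit_ball[of r x] content_ball_conv_unit_ball[of r "0 :: 'a"])

lemma measure_lborel_ball_pos:
  "0 < r \<Longrightarrow> 0 < measure lborel (ball (x :: 'a::euclidean_space) r)"
  using content_ball_pos by blast

lemma emeasure_lborel_ball_eq_measure:
  "emeasure lborel (ball (x :: 'a::euclidean_space) r) = ennreal (measure lborel (ball x r))"
  using emeasure_lborel_ball_finite[of x r] by (intro emeasure_eq_ennreal_measure) auto

lemma nn_integral_indicator_ball_const:
  fixes x :: "'a::euclidean_space"
  shows "(\<integral>\<^sup>+y. indicator (ball x r) y * ennreal c \<partial>lborel) = ennreal (measure lborel (ball x r) * c)"
proof -
  have "(\<integral>\<^sup>+y. indicator (ball x r) y * ennreal c \<partial>lborel) = emeasure lborel (ball x r) * ennreal c"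
    by (subst nn_integral_multc) (auto intro!: borel_measurable_indicator)
  then show ?thesis by (simp add: emeasure_lborel_ball_eq_measure ennreal_mult')
qed

lemma harmonic_on_nn_integral_ball:
  fixes f :: "'a::euclidean_space \<Rightarrow> real"
  assumes "harmonic_on D f" "open D" "0 < r" "cball x r \<subseteq> D" "\<And>y. y \<in> ball x r \<Longrightarrow> 0 \<le> f y"
  shows "(\<integral>\<^sup>+y. indicator (ball x r) y * ennreal (f y) \<partial>lborel) = ennreal (measure lborel (ball x r) * f x)"
proof -
  note mv = harmonic_on_imp_mean_value[OF assms(1-4)]
  have "(\<integral>\<^sup>+y. indicator (ball x r) y * ennreal (f y) \<partial>lborel)
      = (\<integral>\<^sup>+y. ennreal (indicator (ball x r) y * f y) \<partial>lborel)"
    by (intro nn_integral_cong) (auto simp: indicator_def)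
  also have "\<dots> = ennreal (\<integral>y. indicator (ball x r) y * f y \<partial>lborel)"
    using assms(5) by (intro nn_integral_eq_integral mv(1)) (auto simp: indicator_def)
  finally show ?thesis using mv(2) by simp
qed

lemma harmonic_on_le_nn_integral_ball:
  fixes f :: "'a::euclidean_space \<Rightarrow> real"
  assumes "harmonic_on D f" "open D" "0 < r" "cball x r \<subseteq> D"
  shows "ennreal (measure lborel (ball x r) * f x) \<le> (\<integral>\<^sup>+y. indicator (ball x r) y * ennreal (f y) \<partial>lborel)"
proof -
  note mv = harmonic_on_imp_mean_value[OF assms]
  let ?g = "\<lambda>y. indicator (ball x r) y * f y"
  have "ennreal (\<integral>y. ?g y \<partial>lborel) \<le> ennreal (\<integral>y. max 0 (?g y) \<partial>lborel)"
    using mv(1) by (intro ennreal_leI integral_mono) auto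
  also have "\<dots> = (\<integral>\<^sup>+y. ennreal (max 0 (?g y)) \<partial>lborel)"
    using mv(1) by (intro nn_integral_eq_integral[symmetric]) auto
  also have "\<dots> = (\<integral>\<^sup>+y. indicator (ball x r) y * ennreal (f y) \<partial>lborel)"
    by (intro nn_integral_cong) (auto simp: indicator_def max_def ennreal_neg)
  finally show ?thesis using mv(2) by simp
qed

lemma harmonic_on_harnack:
  fixes f :: "'a::euclidean_space \<Rightarrow> real"
  assumes h: "harmonic_on D f" "open D" and "0 < \<rho>" "0 \<le> d" "dist y z \<le> d"
    and sub: "cball z (\<rho> + d) \<subseteq> D" and nonneg: "\<And>y. y \<in> cball z (\<rho> + d) \<Longrightarrow> 0 \<le> f y"
  shows "f y \<le> ((\<rho> + d) / \<rho>) ^ DIM('a) * f z"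
proof -
  have sub1: "cball y \<rho> \<subseteq> cball z (\<rho> + d)"
  proof
    fix w assume "w \<in> cball y \<rho>"
    then show "w \<in> cball z (\<rho> + d)"
      using dist_triangle[of z w y] assms(5) by (simp add: dist_commute)
  qed
  define v where "v = measure lborel (ball (0::'a) 1)"
  have "0 < v" unfolding v_def by (rule measure_lborel_ball_pos) simp
  have meas: "measure lborel (ball c r) = r ^ DIM('a) * v" if "0 < r" for c :: 'a and r
    unfolding v_def using that by (intro content_ball_conv_unit_ball) auto
  have nn: "0 \<le> f w" if "w \<in> ball y \<rho>" for w
    using that nonneg[of w] subsetD[OF sub1, of w] by auto
  have "ennreal (\<rho> ^ DIM('a) * v * f y) = (\<integral>\<^sup>+w. indicator (ball y \<rho>) w * ennreal (f w) \<partial>lborel)"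
    using harmonic_on_nn_integral_ball[OF h \<open>0 < \<rho>\<close>, of y] sub1 sub nn \<open>0 < \<rho>\<close>
    by (subst meas[symmetric, of _ y]) auto
  also have "\<dots> \<le> (\<integral>\<^sup>+w. indicator (ball z (\<rho> + d)) w * ennreal (f w) \<partial>lborel)"
  proof (intro nn_integral_mono mult_right_mono)
    fix w
    have "w \<in> ball z (\<rho> + d)" if "w \<in> ball y \<rho>"
      using that dist_triangle[of z w y] assms(5) by (simp add: dist_commute)
    then show "indicator (ball y \<rho>) w \<le> (indicator (ball z (\<rho> + d)) w :: ennreal)"
      by (auto simp: indicator_def)
  qed auto
  also have "\<dots> = ennreal ((\<rho> + d) ^ DIM('a) * v * f z)"
    using harmonic_on_nn_integral_ball[OF h _ sub] nonneg \<open>0 < \<rho>\<close> \<open>0 \<le> d\<close>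
    by (subst meas[symmetric, of _ z]) auto
  finally have "\<rho> ^ DIM('a) * v * f y \<le> (\<rho> + d) ^ DIM('a) * v * f z"
    using nonneg[of z] \<open>0 < v\<close> \<open>0 < \<rho>\<close> \<open>0 \<le> d\<close> by (simp add: ennreal_le_iff)
  then show ?thesis using \<open>0 < v\<close> \<open>0 < \<rho>\<close> by (simp add: power_divide field_simps)
qed

section \<open>The submean inequality as an inequality of nonnegative integrals\<close>

lemma ball_average_eq:
  fixes f :: "'a::euclidean_space \<Rightarrow> real"
  assumes "0 < r"
  shows "ball_average (\<lambda>y. ereal (f y)) x r = ereal (1 / measure lborel (ball x r)) *
    (enn2ereal (\<integral>\<^sup>+y. indicator (ball x r) y * ennreal (f y) \<partial>lebesgue)
     - enn2ereal (\<integral>\<^sup>+y. indicator (ball x r) y * ennreal (- f y) \<partial>lebesgue))"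
  using assms content_ball_conv_unit_ball[of r x]
  by (simp add: ball_average_def ereal_integral_on_def mult.commute flip: ennreal.abs_eq)

lemma submean_le_nn_integral:
  fixes f :: "'a::euclidean_space \<Rightarrow> real"
  assumes "0 < r" and sm: "ereal (f x) \<le> ball_average (\<lambda>y. ereal (f y)) x r"
  shows "ennreal (measure lborel (ball x r) * f x) \<le> (\<integral>\<^sup>+y. indicator (ball x r) y * ennreal (f y) \<partial>lebesgue)"
    (is "_ \<le> ?P")
proof (cases ?P)
  case (real p)
  define v where "v = measure lborel (ball x r)"
  have "0 < v" using measure_lborel_ball_pos[OF \<open>0 < r\<close>] by (simp add: v_def)
  let ?N = "(\<integral>\<^sup>+y. indicator (ball x r) y * ennreal (- f y) \<partial>lebesgue)"
  have *: "ereal (f x) \<le> ereal (1 / v) * (ereal p - enn2ereal ?N)"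
    using sm real by (simp add: ball_average_eq[OF \<open>0 < r\<close>] v_def)
  show ?thesis
  proof (cases ?N)
    case (real n)
    then have "f x \<le> 1 / v * (p - n)" using * by simp
    then have "v * f x \<le> p - n" using \<open>0 < v\<close> by (simp add: field_simps)
    then show ?thesis using \<open>0 \<le> n\<close> \<open>?P = ennreal p\<close> by (auto simp: v_def intro: ennreal_leI)
  next
    case top
    then show ?thesis using * \<open>0 < v\<close> by simp
  qed
qed auto

text \<open>For a function bounded above by \<open>M\<close>, the submean inequality is an upper bound for the nonnegative
  integral of \<open>M - f\<close>, a form to which Tonelli's theorem applies directly.\<close>

lemma submean_iff_nn_integral:
  fixes f :: "'a::euclidean_space \<Rightarrow> real"
  assumes "0 < r" and meas: "(\<lambda>y. indicator (ball x r) y * f y) \<in> borel_measurable lebesgue"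
    and "0 \<le> M" and bd: "\<And>y. y \<in> ball x r \<Longrightarrow> f y \<le> M"
  shows "ereal (f x) \<le> ball_average (\<lambda>y. ereal (f y)) x r \<longleftrightarrow>
    (\<integral>\<^sup>+y. indicator (ball x r) y * ennreal (M - f y) \<partial>lebesgue)
      \<le> ennreal (measure lborel (ball x r) * (M - f x))"
proof -
  let ?P = "(\<integral>\<^sup>+y. indicator (ball x r) y * ennreal (f y) \<partial>lebesgue)"
  let ?N = "(\<integral>\<^sup>+y. indicator (ball x r) y * ennreal (- f y) \<partial>lebesgue)"
  let ?I = "(\<integral>\<^sup>+y. indicator (ball x r) y * ennreal (M - f y) \<partial>lebesgue)"
  define v where "v = measure lborel (ball x r)"
  have "0 < v" using measure_lborel_ball_pos[OF \<open>0 < r\<close>] by (simp add: v_def)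
  have [measurable]: "ball x r \<in> sets lebesgue" by simp
  have m: "(\<lambda>y. indicator (ball x r) y * ennreal (k (f y))) \<in> borel_measurable lebesgue"
    if "k \<in> borel_measurable borel" for k :: "real \<Rightarrow> real"
  proof -
    have "(\<lambda>y. indicator (ball x r) y * ennreal (k (indicator (ball x r) y * f y))) \<in> borel_measurable lebesgue"
      using meas that by measurable
    also have "(\<lambda>y. indicator (ball x r) y * ennreal (k (indicator (ball x r) y * f y)))
        = (\<lambda>y. indicator (ball x r) y * ennreal (k (f y)))" by (auto simp: indicator_def)
    finally show ?thesis .
  qed
  have M_int: "(\<integral>\<^sup>+y. indicator (ball x r) y * ennreal M \<partial>lebesgue) = ennreal (v * M)"
    using emeasure_lborel_ball_eq_measure[of x r] \<open>0 \<le> M\<close> \<open>0 < v\<close>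
    by (simp add: nn_integral_multc ennreal_mult v_def)
  have "?I + ?P = (\<integral>\<^sup>+y. indicator (ball x r) y * ennreal (M - f y) + indicator (ball x r) y * ennreal (f y) \<partial>lebesgue)"
    using m[of "\<lambda>t. M - t"] m[of "\<lambda>t. t"] by (intro nn_integral_add[symmetric]) auto
  also have "\<dots> = (\<integral>\<^sup>+y. indicator (ball x r) y * ennreal M + indicator (ball x r) y * ennreal (- f y) \<partial>lebesgue)"
  proof (intro nn_integral_cong)
    fix y
    have "ennreal (M - f y) + ennreal (f y) = ennreal M + ennreal (- f y)" if "f y \<le> M"
      using that \<open>0 \<le> M\<close> by (cases "f y \<ge> 0") (auto simp: ennreal_neg simp flip: ennreal_plus)
    then show "indicator (ball x r) y * ennreal (M - f y) + indicator (ball x r) y * ennreal (f y)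
        = indicator (ball x r) y * ennreal M + indicator (ball x r) y * ennreal (- f y)"
      using bd[of y] by (auto simp: indicator_def)
  qed
  also have "\<dots> = ennreal (v * M) + ?N"
    unfolding M_int[symmetric] using m[of "\<lambda>t. M"] m[of "\<lambda>t. - t"] by (intro nn_integral_add) auto
  finally have eq: "?I + ?P = ennreal (v * M) + ?N" .
  have "?P \<le> ennreal (v * M)"
    unfolding M_int[symmetric] using bd
    by (intro nn_integral_mono) (auto simp: indicator_def intro: ennreal_leI)
  then obtain p where p: "?P = ennreal p" "0 \<le> p"
    by (cases ?P) (auto simp: top_unique)
  have "f x \<le> M" using bd \<open>0 < r\<close> by auto
  have avg: "ball_average (\<lambda>y. ereal (f y)) x r = ereal (1 / v) * (ereal p - enn2ereal ?N)"
    using p by (simp add: ball_average_eq[OF \<open>0 < r\<close>] v_def)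
  show ?thesis
  proof (cases ?N)
    case (real n)
    have "?I + ennreal p = ennreal (v * M + n)"
      using eq p real \<open>0 < v\<close> \<open>0 \<le> M\<close> by (simp add: ennreal_plus)
    then obtain i where i: "?I = ennreal i" "0 \<le> i"
      by (cases ?I) auto
    have "i + p = v * M + n"
      using \<open>?I + ennreal p = _\<close> i p real \<open>0 < v\<close> \<open>0 \<le> M\<close> by (simp flip: ennreal_plus)
    have "ereal (f x) \<le> ball_average (\<lambda>y. ereal (f y)) x r \<longleftrightarrow> v * f x \<le> p - n"
      using real \<open>0 < v\<close> by (simp add: avg field_simps)
    also have "\<dots> \<longleftrightarrow> i \<le> v * (M - f x)" using \<open>i + p = v * M + n\<close> by (auto simp: algebra_simps)
    also have "\<dots> \<longleftrightarrow> ?I \<le> ennreal (v * (M - f x))"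
      using i \<open>f x \<le> M\<close> \<open>0 < v\<close> by (simp add: ennreal_le_iff)
    finally show ?thesis by (simp add: v_def)
  next
    case top
    then have "?I = \<infinity>" using eq p by (cases ?I) (auto simp flip: ennreal_plus)
    then show ?thesis using top \<open>0 < v\<close> by (simp add: avg top_unique)
  qed
qed

section \<open>Local upper bounds\<close>

lemma open_slice_fst: "open \<Omega> \<Longrightarrow> open {x. (x, y) \<in> \<Omega>}"
  using open_vimage[of \<Omega> "\<lambda>x. (x, y)"] by (simp add: vimage_def continuous_on_Pair)

lemma open_slice_snd: "open \<Omega> \<Longrightarrow> open {y. (x, y) \<in> \<Omega>}"
  using open_vimage[of \<Omega> "\<lambda>y. (x, y)"] by (simp add: vimage_def continuous_on_Pair)

text \<open>The majorant holds everywhere: it is infinite on a null set. This makes every slice integral of \<open>\<Phi>\<close>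
  an upper bound for that of \<open>g\<close>, without exceptional slices.\<close>

lemma lebesgue_integrable_imp_borel_majorant:
  fixes g :: "'a::euclidean_space \<Rightarrow> real"
  assumes "integrable lebesgue g"
  obtains \<Phi> :: "'a \<Rightarrow> ennreal" where "\<Phi> \<in> borel_measurable borel"
    "\<And>z. ennreal (g z) \<le> \<Phi> z" "(\<integral>\<^sup>+z. \<Phi> z \<partial>lborel) < \<infinity>"
proof -
  have "(\<lambda>z. ennreal (g z)) \<in> borel_measurable lebesgue" using assms by measurable
  then obtain h where h: "h \<in> borel_measurable lborel" "AE z in lborel. ennreal (g z) = h z"
    using completion_ex_borel_measurable by blast
  obtain N where N: "{z \<in> space lborel. ennreal (g z) \<noteq> h z} \<subseteq> N" "N \<in> null_sets lborel"
    using AE_E[OF h(2)] by (metis (no_types, lifting) null_setsI)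
  define \<Phi> where "\<Phi> z = h z + \<infinity> * indicator N z" for z
  have [measurable]: "h \<in> borel_measurable borel" "N \<in> sets borel" using h N by auto
  have "\<Phi> \<in> borel_measurable borel" unfolding \<Phi>_def by measurable
  moreover have "ennreal (g z) \<le> \<Phi> z" for z
  proof (cases "z \<in> N")
    case False
    then have "ennreal (g z) = h z" using N(1) by auto
    then show ?thesis by (simp add: \<Phi>_def)
  qed (simp add: \<Phi>_def)
  moreover have "(\<integral>\<^sup>+z. \<Phi> z \<partial>lborel) < \<infinity>"
  proof -
    have "(\<integral>\<^sup>+z. \<Phi> z \<partial>lborel) = (\<integral>\<^sup>+z. ennreal (g z) \<partial>lborel)"
    proof (rule nn_integral_cong_AE)
      show "AE z in lborel. \<Phi> z = ennreal (g z)"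
        using h(2) AE_not_in[OF N(2)] by eventually_elim (simp add: \<Phi>_def)
    qed
    also have "\<dots> = (\<integral>\<^sup>+z. ennreal (g z) \<partial>lebesgue)" by (rule nn_integral_completion[symmetric])
    also have "\<dots> \<le> (\<integral>\<^sup>+z. ennreal (norm (g z)) \<partial>lebesgue)"
      by (intro nn_integral_mono ennreal_leI) simp
    also have "\<dots> < \<infinity>" using assms by (simp add: integrable_iff_bounded)
    finally show ?thesis .
  qed
  ultimately show ?thesis using that by blast
qed

lemma absolutely_integrable_on_imp_nn_integral_finite:
  fixes f :: "'a::euclidean_space \<Rightarrow> real"
  assumes "f absolutely_integrable_on K"
  shows "(\<lambda>x. indicator K x * ennreal (f x)) \<in> borel_measurable lebesgue"
    and "(\<integral>\<^sup>+x. indicator K x * ennreal (f x) \<partial>lebesgue) < \<infinity>"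
proof -
  have int: "integrable lebesgue (\<lambda>x. indicator K x * f x)"
    using assms by (simp add: set_integrable_def)
  have eq: "(\<lambda>x. indicator K x * ennreal (f x)) = (\<lambda>x. ennreal (indicator K x * f x))"
    by (auto simp: indicator_def)
  show "(\<lambda>x. indicator K x * ennreal (f x)) \<in> borel_measurable lebesgue"
    unfolding eq using int by measurable
  have "(\<integral>\<^sup>+x. ennreal (indicator K x * f x) \<partial>lebesgue) \<le> (\<integral>\<^sup>+x. ennreal (norm (indicator K x * f x)) \<partial>lebesgue)"
    by (intro nn_integral_mono ennreal_leI) simp
  also have "\<dots> < \<infinity>" using int by (simp add: integrable_iff_bounded)
  finally show "(\<integral>\<^sup>+x. indicator K x * ennreal (f x) \<partial>lebesgue) < \<infinity>" unfolding eq .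
qed

lemma open_Times_cball:
  assumes "open \<Omega>" "(x0, y0) \<in> \<Omega>"
  obtains e where "0 < e" "cball x0 e \<times> cball y0 e \<subseteq> \<Omega>"
proof -
  obtain A B where AB: "open A" "open B" "(x0, y0) \<in> A \<times> B" "A \<times> B \<subseteq> \<Omega>"
    using open_prod_elim[OF assms] by blast
  obtain a where a: "a > 0" "cball x0 a \<subseteq> A" using AB by (auto simp: open_contains_cball)
  obtain b where b: "b > 0" "cball y0 b \<subseteq> B" using AB by (auto simp: open_contains_cball)
  have "cball x0 (min a b) \<times> cball y0 (min a b) \<subseteq> \<Omega>"
    using a b AB(4) by (fastforce simp: subset_iff)
  with that[of "min a b"] a b show ?thesis by simp
qed

lemma nearly_subharmonic_harmonic_slices_locally_bounded_above:
  fixes \<Omega> :: "('a::euclidean_space \<times> 'b::euclidean_space) set" and u :: "'a \<times> 'b \<Rightarrow> real"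
  assumes "open \<Omega>"
    and nsh: "\<And>y. nearly_subharmonic_on {x. (x, y) \<in> \<Omega>} (\<lambda>x. ereal (u (x, y)))"
    and harm: "\<And>x. harmonic_on {y. (x, y) \<in> \<Omega>} (\<lambda>y. u (x, y))"
    and \<phi>: "L1_loc \<Omega> \<phi>" "\<And>z. z \<in> \<Omega> \<Longrightarrow> - \<phi> z \<le> u z"
    and z0: "(x0, y0) \<in> \<Omega>"
  shows "\<exists>\<rho>>0. \<exists>M. cball x0 \<rho> \<times> cball y0 \<rho> \<subseteq> \<Omega> \<and>
      (\<forall>x\<in>cball x0 \<rho>. \<forall>y\<in>cball y0 \<rho>. u (x, y) \<le> M)"
proof -
  obtain e where "0 < e" and e: "cball x0 e \<times> cball y0 e \<subseteq> \<Omega>"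
    using open_Times_cball[OF \<open>open \<Omega>\<close> z0] .
  \<comment> \<open>in the \<open>y\<close> directions: \<open>u + a / v \<ge> 0\<close> on radius \<open>3 * r\<close>, Harnack between points of \<open>cball y0 r\<close> and \<open>y0\<close>\<close>
  define r where "r = e / 4"
  have "0 < r" and e_eq: "e = 4 * r" using \<open>0 < e\<close> by (auto simp: r_def)
  define K where "K = cball x0 (4 * r) \<times> cball y0 (4 * r)"
  have K: "compact K" "K \<subseteq> \<Omega>" using e by (auto simp: K_def e_eq intro: compact_Times)
  have "\<phi> absolutely_integrable_on K" using \<phi>(1) K by (auto simp: L1_loc_def)
  then have "integrable lebesgue (\<lambda>z. indicator K z * \<phi> z)" by (simp add: set_integrable_def)
  then obtain \<Phi> :: "'a \<times> 'b \<Rightarrow> ennreal" where \<Phi>_meas: "\<Phi> \<in> borel_measurable borel"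
    and \<Phi>: "\<And>z. ennreal (indicator K z * \<phi> z) \<le> \<Phi> z" and \<Phi>_fin: "(\<integral>\<^sup>+z. \<Phi> z \<partial>lborel) < \<infinity>"
    using lebesgue_integrable_imp_borel_majorant by blast
  have \<Phi>_meas': "\<Phi> \<in> borel_measurable (lborel \<Otimes>\<^sub>M lborel)" unfolding lborel_prod using \<Phi>_meas by simp
  define S where "S x = (\<integral>\<^sup>+y. \<Phi> (x, y) \<partial>lborel)" for x
  have S_meas [measurable]: "S \<in> borel_measurable borel"
    unfolding S_def using lborel.borel_measurable_nn_integral_fst[OF \<Phi>_meas'] by simp
  have S_fin: "(\<integral>\<^sup>+x. S x \<partial>lborel) < \<infinity>"
    unfolding S_def using lborel.nn_integral_fst[OF \<Phi>_meas'] \<Phi>_fin by (simp add: lborel_prod)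
  define v where "v = measure lborel (ball (0::'b) r)"
  have "0 < v" unfolding v_def by (rule measure_lborel_ball_pos[OF \<open>0 < r\<close>])
  have v: "measure lborel (ball y r) = v" for y :: 'b
    using measure_lborel_ball_translate[of r y] \<open>0 < r\<close> by (simp add: v_def)
  define w where "w = measure lborel (ball (0::'a) r)"
  have "0 < w" unfolding w_def by (rule measure_lborel_ball_pos[OF \<open>0 < r\<close>])
  have w: "measure lborel (ball x r) = w" for x :: 'a
    using measure_lborel_ball_translate[of r x] \<open>0 < r\<close> by (simp add: w_def)
  \<comment> \<open>the majorant of \<open>u (x, y)\<close>, uniform in \<open>y \<in> cball y0 r\<close>; trivial where \<open>S x\<close> is infinite\<close>
  define \<Psi> where "\<Psi> x = ennreal (2 ^ DIM('b)) * (ennreal (u (x, y0)) + ennreal (1 / v) * S x)" for x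

  have u_le: "ennreal (u (x, y)) \<le> \<Psi> x" if x: "x \<in> cball x0 (4 * r)" and y: "y \<in> cball y0 r" for x y
  proof (cases "S x")
    case top
    then show ?thesis using \<open>0 < v\<close> by (simp add: \<Psi>_def ennreal_mult_top)
  next
    case (real a)
    have lower: "0 \<le> u (x, y') + a / v" if y': "y' \<in> cball y0 (3 * r)" for y'
    proof -
      have sub: "cball y' r \<subseteq> cball y0 (4 * r)"
        using y' by (simp add: cball_subset_cball_iff dist_commute)
      have h: "harmonic_on {y. (x, y) \<in> \<Omega>} (\<lambda>y. - u (x, y))"
        using harmonic_on_affine[OF harm[of x], of "-1" 0] by simp
      have "ennreal (measure lborel (ball y' r) * - u (x, y'))
          \<le> (\<integral>\<^sup>+y. indicator (ball y' r) y * ennreal (- u (x, y)) \<partial>lborel)"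
        using sub x K by (intro harmonic_on_le_nn_integral_ball[OF h open_slice_snd[OF \<open>open \<Omega>\<close>] \<open>0 < r\<close>])
          (auto simp: K_def)
      also have "\<dots> \<le> S x"
        unfolding S_def
      proof (rule nn_integral_mono)
        fix y
        have "ennreal (- u (x, y)) \<le> \<Phi> (x, y)" if "y \<in> ball y' r"
        proof -
          have "(x, y) \<in> K" using subsetD[OF sub, of y] that x by (auto simp: K_def)
          then have "- u (x, y) \<le> indicator K (x, y) * \<phi> (x, y)" using \<phi>(2)[of "(x, y)"] K by auto
          then show ?thesis using \<Phi>[of "(x, y)"] ennreal_leI order_trans by blast
        qed
        then show "indicator (ball y' r) y * ennreal (- u (x, y)) \<le> \<Phi> (x, y)"
          by (auto simp: indicator_def)
      qed
      finally have "v * - u (x, y') \<le> a" using real by (simp add: v ennreal_le_iff)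
      then show ?thesis using \<open>0 < v\<close> by (simp add: field_simps)
    qed
    have h: "harmonic_on {y. (x, y) \<in> \<Omega>} (\<lambda>y. u (x, y) + a / v)"
      using harmonic_on_affine[OF harm[of x], of 1 "a / v"] by simp
    have "u (x, y) + a / v \<le> ((r + r) / r) ^ DIM('b) * (u (x, y0) + a / v)"
      using x y lower K \<open>0 < r\<close>
      by (intro harmonic_on_harnack[OF h open_slice_snd[OF \<open>open \<Omega>\<close>] \<open>0 < r\<close>])
        (auto simp: dist_commute K_def)
    also have "(r + r) / r = 2" using \<open>0 < r\<close> by (simp add: field_simps)
    finally have "u (x, y) \<le> 2 ^ DIM('b) * (u (x, y0) + a / v)"
      using real \<open>0 < v\<close> divide_nonneg_pos[of a v] by linarith
    also have "\<dots> \<le> 2 ^ DIM('b) * (max 0 (u (x, y0)) + a / v)" by (intro mult_left_mono) auto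
    finally have "ennreal (u (x, y)) \<le> ennreal (2 ^ DIM('b) * (max 0 (u (x, y0)) + a / v))"
      by (rule ennreal_leI)
    also have "\<dots> = ennreal (2 ^ DIM('b)) * (ennreal (max 0 (u (x, y0))) + ennreal (1 / v * a))"
      using real \<open>0 < v\<close> by (simp add: ennreal_mult ennreal_plus)
    also have "\<dots> = \<Psi> x"
      using real \<open>0 < v\<close> by (simp add: \<Psi>_def max_def ennreal_neg flip: ennreal_mult)
    finally show ?thesis .
  qed

  let ?B = "cball x0 (2 * r)"
  let ?T = "\<integral>\<^sup>+x. indicator ?B x * \<Psi> x \<partial>lebesgue"
  have T_fin: "?T < \<infinity>"
  proof -
    have "?B \<subseteq> {x. (x, y0) \<in> \<Omega>}" using K \<open>0 < r\<close> by (auto simp: K_def)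
    then have "(\<lambda>x. real_of_ereal (max (ereal (u (x, y0))) 0)) absolutely_integrable_on ?B"
      using nsh[of y0] by (auto simp: nearly_subharmonic_on_def L1_loc_def)
    from absolutely_integrable_on_imp_nn_integral_finite[OF this]
    have U: "(\<lambda>x. indicator ?B x * ennreal (real_of_ereal (max (ereal (u (x, y0))) 0))) \<in> borel_measurable lebesgue"
      "(\<integral>\<^sup>+x. indicator ?B x * ennreal (real_of_ereal (max (ereal (u (x, y0))) 0)) \<partial>lebesgue) < \<infinity>" .
    have pos: "ennreal (real_of_ereal (max (ereal t) 0)) = ennreal t" for t
      by (cases "t \<ge> 0") (auto simp: max_def ennreal_neg zero_ereal_def)
    have S_meas': "S \<in> borel_measurable lebesgue" by (rule measurable_completion) simp
    have B_meas: "?B \<in> sets lebesgue" by simp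
    have "?T = (\<integral>\<^sup>+x. ennreal (2 ^ DIM('b)) * (indicator ?B x * ennreal (u (x, y0)) + ennreal (1 / v) * (indicator ?B x * S x)) \<partial>lebesgue)"
      by (intro nn_integral_cong) (simp add: \<Psi>_def distrib_left mult_ac)
    also have "\<dots> = ennreal (2 ^ DIM('b)) * ((\<integral>\<^sup>+x. indicator ?B x * ennreal (u (x, y0)) \<partial>lebesgue)
        + ennreal (1 / v) * (\<integral>\<^sup>+x. indicator ?B x * S x \<partial>lebesgue))"
    proof -
      have m1: "(\<lambda>x. indicator ?B x * ennreal (u (x, y0))) \<in> borel_measurable lebesgue"
        using U(1) by (simp add: pos)
      have m2 [measurable]: "(\<lambda>x. indicator ?B x * S x) \<in> borel_measurable lebesgue"
        using S_meas' B_meas by measurable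
      have m3: "(\<lambda>x. ennreal (1 / v) * (indicator ?B x * S x)) \<in> borel_measurable lebesgue"
        by measurable
      show ?thesis
        by (simp only: nn_integral_cmult[OF borel_measurable_add[OF m1 m3]] nn_integral_add[OF m1 m3]
            nn_integral_cmult[OF m2])
    qed
    also have "\<dots> < \<infinity>"
    proof -
      have "(\<integral>\<^sup>+x. indicator ?B x * S x \<partial>lebesgue) \<le> (\<integral>\<^sup>+x. S x \<partial>lebesgue)"
        by (intro nn_integral_mono) (auto simp: indicator_def)
      also have "\<dots> < \<infinity>" using S_fin by (simp add: nn_integral_completion)
      finally show ?thesis using U(2) by (simp add: pos ennreal_mult_less_top)
    qed
    finally show ?thesis .
  qed
  have "u (x, y) \<le> enn2real ?T / w" if x: "x \<in> cball x0 r" and y: "y \<in> cball y0 r" for x y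
  proof -
    have sub: "cball x r \<subseteq> ?B" using x by (simp add: cball_subset_cball_iff dist_commute)
    have "cball x r \<subseteq> {x. (x, y) \<in> \<Omega>}" using sub y K \<open>0 < r\<close> by (force simp: K_def)
    then have "ereal (u (x, y)) \<le> ball_average (\<lambda>x. ereal (u (x, y))) x r"
      using nsh[of y] \<open>0 < r\<close> by (simp add: nearly_subharmonic_on_def submean_on_def)
    from submean_le_nn_integral[OF \<open>0 < r\<close> this]
    have "ennreal (w * u (x, y)) \<le> (\<integral>\<^sup>+x'. indicator (ball x r) x' * ennreal (u (x', y)) \<partial>lebesgue)"
      by (simp add: w)
    also have "\<dots> \<le> ?T"
    proof (rule nn_integral_mono)
      fix x'
      have "x' \<in> ?B" if "x' \<in> ball x r" using that sub ball_subset_cball[of x r] by blast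
      moreover have "ennreal (u (x', y)) \<le> \<Psi> x'" if "x' \<in> ?B"
        using u_le[OF _ y, of x'] that \<open>0 < r\<close> by auto
      ultimately show "indicator (ball x r) x' * ennreal (u (x', y)) \<le> indicator ?B x' * \<Psi> x'"
        by (auto simp: indicator_def)
    qed
    also have "?T = ennreal (enn2real ?T)" using T_fin by simp
    finally have "w * u (x, y) \<le> enn2real ?T" by (simp add: ennreal_le_iff)
    then show ?thesis using \<open>0 < w\<close> by (simp add: field_simps)
  qed
  moreover have "cball x0 r \<times> cball y0 r \<subseteq> \<Omega>" using K \<open>0 < r\<close> by (force simp: K_def)
  ultimately show ?thesis using \<open>0 < r\<close> by blast
qed

section \<open>Upper semicontinuity\<close>

lemma usc_on_open_iff:
  "open D \<Longrightarrow> usc_on D f \<longleftrightarrow> (\<forall>a. open {x \<in> D. f x < a})"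
  unfolding usc_on_def by (auto simp: openin_open_eq)

lemma AE_lebesgue_ball_point:
  fixes y0 :: "'a::euclidean_space"
  assumes "AE y in lebesgue. P y" "0 < d"
  obtains y where "y \<in> ball y0 d" "P y"
proof -
  have "\<exists>y \<in> ball y0 d. P y"
  proof (rule ccontr)
    assume "\<not> ?thesis"
    with assms(1) have "AE y in lebesgue. y \<notin> ball y0 d" by (auto elim: eventually_mono)
    then have "emeasure lebesgue (ball y0 d) = 0"
      by (subst (asm) AE_iff_measurable[of "ball y0 d"]) auto
    moreover have "emeasure lebesgue (ball y0 d) = ennreal (measure lborel (ball y0 d))"
      using emeasure_lborel_ball_eq_measure[of y0 d] by simp
    ultimately show False using measure_lborel_ball_pos[OF \<open>0 < d\<close>, of y0] by simp
  qed
  with that show ?thesis by blast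
qed

lemma usc_on_if_usc_harmonic_slices:
  fixes \<Omega> :: "('a::euclidean_space \<times> 'b::euclidean_space) set" and u :: "'a \<times> 'b \<Rightarrow> real"
  assumes "open \<Omega>"
    and usc: "AE y in lebesgue. usc_on {x. (x, y) \<in> \<Omega>} (\<lambda>x. ereal (u (x, y)))"
    and harm: "\<And>x. harmonic_on {y. (x, y) \<in> \<Omega>} (\<lambda>y. u (x, y))"
    and bound: "\<And>x0 y0. (x0, y0) \<in> \<Omega> \<Longrightarrow> \<exists>\<rho>>0. \<exists>M. cball x0 \<rho> \<times> cball y0 \<rho> \<subseteq> \<Omega> \<and>
      (\<forall>x\<in>cball x0 \<rho>. \<forall>y\<in>cball y0 \<rho>. u (x, y) \<le> M)"
  shows "usc_on \<Omega> (\<lambda>z. ereal (u z))"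
proof -
  have "open {z \<in> \<Omega>. u z < a}" for a
  proof (rule open_prod_intro)
    fix z assume "z \<in> {z \<in> \<Omega>. u z < a}"
    then obtain x0 y0 where z: "z = (x0, y0)" "(x0, y0) \<in> \<Omega>" "u (x0, y0) < a" by (cases z) auto
    obtain \<rho> M where "\<rho> > 0" and sub: "cball x0 \<rho> \<times> cball y0 \<rho> \<subseteq> \<Omega>"
      and M: "\<And>x y. x \<in> cball x0 \<rho> \<Longrightarrow> y \<in> cball y0 \<rho> \<Longrightarrow> u (x, y) \<le> M"
      using bound[OF z(2)] by blast
    \<comment> \<open>the Harnack constant for two points of \<open>cball y0 d\<close>, compared through balls of radius \<open>\<rho> / 2\<close>\<close>
    define q where "q d = ((\<rho> / 2 + 2 * d) / (\<rho> / 2)) ^ DIM('b)" for d :: real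
    have "((\<lambda>d. q d * (q d * (M - a))) \<longlongrightarrow> q 0 * (q 0 * (M - a))) (at_right 0)"
      unfolding q_def using \<open>\<rho> > 0\<close> by (intro tendsto_intros) auto
    moreover have "q 0 * (q 0 * (M - a)) < M - u (x0, y0)" using z(3) \<open>\<rho> > 0\<close> by (simp add: q_def)
    ultimately have "eventually (\<lambda>d. q d * (q d * (M - a)) < M - u (x0, y0)) (at_right 0)"
      by (rule order_tendstoD)
    moreover have "eventually (\<lambda>d. d < \<rho> / 8) (at_right 0)"
      using \<open>\<rho> > 0\<close> by (intro order_tendstoD(2)[OF tendsto_ident_at]) simp
    moreover have "eventually (\<lambda>d. 0 < d) (at_right (0::real))"
      by (rule eventually_at_right_less)
    ultimately have "eventually (\<lambda>d. q d * (q d * (M - a)) < M - u (x0, y0) \<and> d < \<rho> / 8 \<and> 0 < d) (at_right 0)"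
      by eventually_elim auto
    then obtain d where d: "q d * (q d * (M - a)) < M - u (x0, y0)" "d < \<rho> / 8" "0 < d"
      using eventually_happens[of _ "at_right (0::real)"] by force
    have "q d > 0" using d \<open>\<rho> > 0\<close> by (simp add: q_def)
    \<comment> \<open>\<open>d < \<rho> / 8\<close> keeps the balls of radius \<open>\<rho> / 2 + 2 * d\<close> about points of \<open>cball y0 d\<close> inside \<open>cball y0 \<rho>\<close>\<close>
    have harnack: "M - u (x, y) \<le> q d * (M - u (x, y'))"
      if x: "x \<in> cball x0 \<rho>" and y: "y \<in> cball y0 d" "y' \<in> cball y0 d" for x y y'
    proof -
      have h: "harmonic_on {y. (x, y) \<in> \<Omega>} (\<lambda>y. M - u (x, y))"
        using harmonic_on_affine[OF harm[of x], of "-1" M] by simp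
      have sub': "cball y' (\<rho> / 2 + 2 * d) \<subseteq> cball y0 \<rho>"
        using y d by (simp add: cball_subset_cball_iff dist_commute)
      have "dist y y' \<le> 2 * d" using y dist_triangle[of y y' y0] by (simp add: dist_commute)
      then show ?thesis unfolding q_def
        using x sub sub' M d \<open>\<rho> > 0\<close>
        by (intro harmonic_on_harnack[OF h open_slice_snd[OF \<open>open \<Omega>\<close>]]) auto
    qed
    obtain y1 where y1: "y1 \<in> ball y0 d" "usc_on {x. (x, y1) \<in> \<Omega>} (\<lambda>x. ereal (u (x, y1)))"
      using AE_lebesgue_ball_point[OF usc \<open>0 < d\<close>] by blast
    define A where "A = {x \<in> {x. (x, y1) \<in> \<Omega>}. ereal (u (x, y1)) < ereal (M - q d * (M - a))} \<inter> ball x0 \<rho>"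
    have "open A"
      using y1(2) unfolding A_def usc_on_open_iff[OF open_slice_fst[OF \<open>open \<Omega>\<close>]] by blast
    moreover have "x0 \<in> A"
    proof -
      have "q d * (q d * (M - a)) < q d * (M - u (x0, y1))"
        using harnack[of x0 y0 y1] d y1(1) \<open>\<rho> > 0\<close> by auto
      then have "q d * (M - a) < M - u (x0, y1)" using \<open>q d > 0\<close> by simp
      then show ?thesis using sub y1(1) d \<open>\<rho> > 0\<close> by (auto simp: A_def)
    qed
    moreover have "A \<times> ball y0 d \<subseteq> {z \<in> \<Omega>. u z < a}"
    proof safe
      fix x y assume xy: "x \<in> A" "y \<in> ball y0 d"
      then show "(x, y) \<in> \<Omega>" using sub d by (auto simp: A_def)
      have "q d * (M - a) < M - u (x, y1)" using xy by (auto simp: A_def)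
      also have "\<dots> \<le> q d * (M - u (x, y))" using xy y1 by (intro harnack) (auto simp: A_def)
      finally show "u (x, y) < a" using \<open>q d > 0\<close> by simp
    qed
    ultimately show "\<exists>A B. open A \<and> open B \<and> z \<in> A \<times> B \<and> A \<times> B \<subseteq> {z \<in> \<Omega>. u z < a}"
      using z d by (intro exI[of _ A] exI[of _ "ball y0 d"]) auto
  qed
  then have "open {z \<in> \<Omega>. ereal (u z) < a}" for a
    using \<open>open \<Omega>\<close> by (cases a) auto
  then show ?thesis by (simp add: usc_on_open_iff[OF \<open>open \<Omega>\<close>])
qed

section \<open>The submean inequality on the product space\<close>

lemma mem_ball_Pair_iff:
  fixes x x0 :: "'a::euclidean_space" and y y0 :: "'b::euclidean_space"
  assumes "0 < r"
  shows "(x, y) \<in> ball (x0, y0) r \<longleftrightarrow> (dist x0 x)\<^sup>2 + (dist y0 y)\<^sup>2 < r\<^sup>2"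
    and "(x, y) \<in> cball (x0, y0) r \<longleftrightarrow> (dist x0 x)\<^sup>2 + (dist y0 y)\<^sup>2 \<le> r\<^sup>2"
  using assms real_sqrt_less_iff[of "(dist x0 x)\<^sup>2 + (dist y0 y)\<^sup>2" "r\<^sup>2"]
    real_sqrt_le_iff[of "(dist x0 x)\<^sup>2 + (dist y0 y)\<^sup>2" "r\<^sup>2"]
  by (simp_all add: dist_Pair_Pair)

lemma borel_measurable_usc_on_indicator:
  fixes u :: "'a::euclidean_space \<Rightarrow> real"
  assumes "usc_on D (\<lambda>z. ereal (u z))" "open D" "open B" "B \<subseteq> D"
  shows "(\<lambda>z. indicator B z * u z) \<in> borel_measurable borel"
  unfolding borel_measurable_iff_less
proof
  fix a :: real
  have "open {z \<in> D. u z < a}"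
    using iffD1[OF usc_on_open_iff[OF assms(2)] assms(1), rule_format, of "ereal a"] by simp
  then have [measurable]: "B \<inter> {z \<in> D. u z < a} \<in> sets borel" "- B \<in> sets borel" using assms(3) by auto
  have "{z. indicator B z * u z < a} = (if 0 < a then - B \<union> (B \<inter> {z \<in> D. u z < a}) else B \<inter> {z \<in> D. u z < a})"
    using assms(4) by (auto simp: indicator_def split: if_splits)
  then show "{z \<in> space borel. indicator B z * u z < a} \<in> sets borel" by simp
qed

lemma usc_on_bounded_above_compact:
  fixes u :: "'a::euclidean_space \<Rightarrow> real"
  assumes "usc_on D (\<lambda>z. ereal (u z))" "open D" "compact K" "K \<subseteq> D"
  obtains M where "0 \<le> M" "\<And>z. z \<in> K \<Longrightarrow> u z \<le> M"
proof -
  have op: "open {z \<in> D. ereal (u z) < ereal (real k)}" for k :: nat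
    using iffD1[OF usc_on_open_iff[OF assms(2)] assms(1)] by blast
  have cover: "K \<subseteq> (\<Union>k\<in>UNIV. {z \<in> D. ereal (u z) < ereal (real k)})"
    using subsetD[OF assms(4)] by (simp add: subset_iff reals_Archimedean2)
  obtain C :: "nat set" where C: "finite C" "K \<subseteq> (\<Union>k\<in>C. {z \<in> D. ereal (u z) < ereal (real k)})"
    by (rule compactE_image[OF assms(3) op cover]) (use that in blast)
  have "u z \<le> real (\<Sum>C)" if z: "z \<in> K" for z
  proof -
    obtain k where "k \<in> C" "u z < real k" using C(2) z by auto
    moreover have "k \<le> \<Sum>C" using member_le_sum[OF \<open>k \<in> C\<close>, of "\<lambda>k. k"] C(1) by simp
    ultimately show ?thesis by linarith
  qed
  then show ?thesis by (rule that[OF of_nat_0_le_iff])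
qed

lemma submean_on_if_submean_harmonic_slices:
  fixes \<Omega> :: "('a::euclidean_space \<times> 'b::euclidean_space) set" and u :: "'a \<times> 'b \<Rightarrow> real"
  assumes "open \<Omega>" and usc: "usc_on \<Omega> (\<lambda>z. ereal (u z))"
    and sm: "\<And>y. submean_on {x. (x, y) \<in> \<Omega>} (\<lambda>x. ereal (u (x, y)))"
    and harm: "\<And>x. harmonic_on {y. (x, y) \<in> \<Omega>} (\<lambda>y. u (x, y))"
  shows "submean_on \<Omega> (\<lambda>z. ereal (u z))"
  unfolding submean_on_def
proof (intro allI impI)
  fix z :: "'a \<times> 'b" and r :: real
  assume "0 < r" and sub: "cball z r \<subseteq> \<Omega>"
  obtain x0 y0 where z: "z = (x0, y0)" by (cases z)
  define B where "B = ball z r"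
  have [measurable]: "B \<in> sets borel" and "open B" and BO: "B \<subseteq> \<Omega>"
    using sub ball_subset_cball[of z r] by (auto simp: B_def)
  obtain M where "0 \<le> M" and M: "\<And>w. w \<in> cball z r \<Longrightarrow> u w \<le> M"
    using usc_on_bounded_above_compact[OF usc \<open>open \<Omega>\<close> compact_cball sub] by blast
  have in_B: "(x, y) \<in> B \<longleftrightarrow> (dist x0 x)\<^sup>2 + (dist y0 y)\<^sup>2 < r\<^sup>2"
    and in_cball: "(x, y) \<in> cball z r \<longleftrightarrow> (dist x0 x)\<^sup>2 + (dist y0 y)\<^sup>2 \<le> r\<^sup>2" for x y
    unfolding B_def z by (rule mem_ball_Pair_iff[OF \<open>0 < r\<close>])+
  \<comment> \<open>\<open>u\<close> is Borel measurable only on \<open>\<Omega>\<close>; cut off outside \<open>B\<close> it is so everywhere\<close>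
  define v where "v w = indicator B w * u w" for w
  have v_meas [measurable]: "v \<in> borel_measurable borel"
    unfolding v_def by (rule borel_measurable_usc_on_indicator[OF usc \<open>open \<Omega>\<close> \<open>open B\<close> BO])
  define c where "c = M - u (x0, y0)"
  have "0 \<le> c" using M[of "(x0, y0)"] \<open>0 < r\<close> by (simp add: c_def z)
  have in_B0: "(x, y0) \<in> B" if "(x, y) \<in> B" for x y
    using that zero_le_power2[of "dist y0 y"] unfolding in_B dist_self power_zero_numeral by linarith

  have f_meas: "(\<lambda>w. indicator B w * ennreal (M - v w)) \<in> borel_measurable (lborel \<Otimes>\<^sub>M lborel)"
    unfolding lborel_prod by simp
  have g_meas: "(\<lambda>w. indicator B w * ennreal (M - v (fst w, y0))) \<in> borel_measurable (lborel \<Otimes>\<^sub>M lborel)"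
  proof -
    have "(\<lambda>w::'a \<times> 'b. (fst w, y0)) \<in> borel_measurable borel"
      by (intro borel_measurable_continuous_onI continuous_intros)
    from measurable_compose[OF this v_meas] show ?thesis unfolding lborel_prod by simp
  qed

  have "(\<integral>\<^sup>+w. indicator B w * ennreal (M - u w) \<partial>lborel)
      = (\<integral>\<^sup>+w. indicator B w * ennreal (M - v w) \<partial>(lborel \<Otimes>\<^sub>M lborel))"
    unfolding lborel_prod by (intro nn_integral_cong) (auto simp: v_def indicator_def)
  also have "\<dots> = (\<integral>\<^sup>+x. \<integral>\<^sup>+y. indicator B (x, y) * ennreal (M - v (x, y)) \<partial>lborel \<partial>lborel)"
    using lborel.nn_integral_fst[OF f_meas] by simp
  also have "\<dots> = (\<integral>\<^sup>+x. \<integral>\<^sup>+y. indicator B (x, y) * ennreal (M - v (x, y0)) \<partial>lborel \<partial>lborel)"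
  proof (rule nn_integral_cong)
    fix x
    show "(\<integral>\<^sup>+y. indicator B (x, y) * ennreal (M - v (x, y)) \<partial>lborel)
        = (\<integral>\<^sup>+y. indicator B (x, y) * ennreal (M - v (x, y0)) \<partial>lborel)"
    proof (cases "dist x0 x < r")
      case True
      define s where "s = sqrt (r\<^sup>2 - (dist x0 x)\<^sup>2)"
      have "(dist x0 x)\<^sup>2 < r\<^sup>2" using True by (intro power_strict_mono) auto
      then have "s > 0" and s2: "s\<^sup>2 = r\<^sup>2 - (dist x0 x)\<^sup>2" by (auto simp: s_def)
      have sl: "(x, y) \<in> B \<longleftrightarrow> y \<in> ball y0 s" for y
        using power_mono_iff[of s "dist y0 y" 2] s2 \<open>s > 0\<close> unfolding in_B mem_ball by auto
      have cb: "(x, y) \<in> cball z r" if "y \<in> cball y0 s" for y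
        using power_mono[of "dist y0 y" s 2] that s2 unfolding in_cball by auto
      have h: "harmonic_on {y. (x, y) \<in> \<Omega>} (\<lambda>y. M - u (x, y))"
        using harmonic_on_affine[OF harm[of x], of "-1" M] by simp
      have "(\<integral>\<^sup>+y. indicator B (x, y) * ennreal (M - v (x, y)) \<partial>lborel)
          = (\<integral>\<^sup>+y. indicator (ball y0 s) y * ennreal (M - u (x, y)) \<partial>lborel)"
        by (intro nn_integral_cong) (auto simp: v_def indicator_def sl)
      also have "\<dots> = ennreal (measure lborel (ball y0 s) * (M - u (x, y0)))"
        using cb sub M \<open>s > 0\<close>
        by (intro harmonic_on_nn_integral_ball[OF h open_slice_snd[OF \<open>open \<Omega>\<close>]]) auto
      also have "\<dots> = (\<integral>\<^sup>+y. indicator (ball y0 s) y * ennreal (M - u (x, y0)) \<partial>lborel)"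
        by (rule nn_integral_indicator_ball_const[symmetric])
      also have "\<dots> = (\<integral>\<^sup>+y. indicator B (x, y) * ennreal (M - v (x, y0)) \<partial>lborel)"
      proof (rule nn_integral_cong)
        fix y
        show "indicator (ball y0 s) y * ennreal (M - u (x, y0)) = indicator B (x, y) * ennreal (M - v (x, y0))"
          using sl[of y] in_B0[of x y] by (auto simp: v_def indicator_def)
      qed
      finally show ?thesis .
    next
      case False
      then have "(x, y) \<notin> B" for y
        using power_mono[of r "dist x0 x" 2] \<open>0 < r\<close> zero_le_power2[of "dist y0 y"]
        unfolding in_B by linarith
      then show ?thesis by simp
    qed
  qed
  also have "\<dots> = (\<integral>\<^sup>+y. \<integral>\<^sup>+x. indicator B (x, y) * ennreal (M - v (x, y0)) \<partial>lborel \<partial>lborel)"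
    using lborel_pair.Fubini[OF g_meas] by simp
  also have "\<dots> \<le> (\<integral>\<^sup>+y. \<integral>\<^sup>+x. indicator B (x, y) * ennreal c \<partial>lborel \<partial>lborel)"
  proof (rule nn_integral_mono)
    fix y
    show "(\<integral>\<^sup>+x. indicator B (x, y) * ennreal (M - v (x, y0)) \<partial>lborel)
        \<le> (\<integral>\<^sup>+x. indicator B (x, y) * ennreal c \<partial>lborel)"
    proof (cases "dist y0 y < r")
      case True
      define s where "s = sqrt (r\<^sup>2 - (dist y0 y)\<^sup>2)"
      have "(dist y0 y)\<^sup>2 < r\<^sup>2" using True by (intro power_strict_mono) auto
      then have "s > 0" and s2: "s\<^sup>2 = r\<^sup>2 - (dist y0 y)\<^sup>2" by (auto simp: s_def)
      have sl: "(x, y) \<in> B \<longleftrightarrow> x \<in> ball x0 s" for x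
        using power_mono_iff[of s "dist x0 x" 2] s2 \<open>s > 0\<close> unfolding in_B mem_ball by auto
      have cb: "(x, y0) \<in> cball z r" if "x \<in> cball x0 s" for x
      proof -
        have "(dist x0 x)\<^sup>2 \<le> s\<^sup>2" using that by (intro power_mono) auto
        also have "\<dots> \<le> r\<^sup>2" by (simp add: s2)
        finally show ?thesis unfolding in_cball by simp
      qed
      have "(\<integral>\<^sup>+x. indicator B (x, y) * ennreal (M - v (x, y0)) \<partial>lborel)
          = (\<integral>\<^sup>+x. indicator (ball x0 s) x * ennreal (M - u (x, y0)) \<partial>lborel)"
      proof (rule nn_integral_cong)
        fix x
        show "indicator B (x, y) * ennreal (M - v (x, y0)) = indicator (ball x0 s) x * ennreal (M - u (x, y0))"
          using sl[of x] in_B0[of x y] by (auto simp: v_def indicator_def)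
      qed
      also have "\<dots> = (\<integral>\<^sup>+x. indicator (ball x0 s) x * ennreal (M - u (x, y0)) \<partial>lebesgue)"
        by (rule nn_integral_completion[symmetric])
      also have "\<dots> \<le> ennreal (measure lborel (ball x0 s) * (M - u (x0, y0)))"
      proof (subst submean_iff_nn_integral[symmetric, of s x0 "\<lambda>x. u (x, y0)"])
        have "(\<lambda>x. indicator (ball x0 s) x * v (x, y0)) \<in> borel_measurable lborel"
        proof -
          have "(\<lambda>x::'a. (x, y0)) \<in> borel_measurable borel"
            by (intro borel_measurable_continuous_onI continuous_intros)
          from measurable_compose[OF this v_meas] show ?thesis
            by (auto intro!: borel_measurable_times borel_measurable_indicator)
        qed
        also have "(\<lambda>x. indicator (ball x0 s) x * v (x, y0)) = (\<lambda>x. indicator (ball x0 s) x * u (x, y0))"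
        proof
          fix x
          show "indicator (ball x0 s) x * v (x, y0) = indicator (ball x0 s) x * u (x, y0)"
            using sl[of x] in_B0[of x y] by (auto simp: v_def indicator_def)
        qed
        finally show "(\<lambda>x. indicator (ball x0 s) x * u (x, y0)) \<in> borel_measurable lebesgue"
          by (rule measurable_completion)
        show "ereal (u (x0, y0)) \<le> ball_average (\<lambda>x. ereal (u (x, y0))) x0 s"
        proof -
          have "cball x0 s \<subseteq> {x. (x, y0) \<in> \<Omega>}" using cb sub by blast
          then show ?thesis using sm[of y0] \<open>s > 0\<close> by (simp add: submean_on_def)
        qed
      qed (use \<open>s > 0\<close> \<open>0 \<le> M\<close> M cb in auto)
      also have "\<dots> = (\<integral>\<^sup>+x. indicator (ball x0 s) x * ennreal c \<partial>lborel)"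
        unfolding c_def by (rule nn_integral_indicator_ball_const[symmetric])
      also have "\<dots> = (\<integral>\<^sup>+x. indicator B (x, y) * ennreal c \<partial>lborel)"
        by (intro nn_integral_cong) (auto simp: indicator_def sl)
      finally show ?thesis .
    next
      case False
      then have "(x, y) \<notin> B" for x
        using power_mono[of r "dist y0 y" 2] \<open>0 < r\<close> zero_le_power2[of "dist x0 x"]
        unfolding in_B by linarith
      then show ?thesis by simp
    qed
  qed
  also have "\<dots> = (\<integral>\<^sup>+w. indicator B w * ennreal c \<partial>(lborel \<Otimes>\<^sub>M lborel))"
    by (rule lborel_pair.nn_integral_snd) (simp add: lborel_prod)
  also have "\<dots> = ennreal (measure lborel B * c)"
    unfolding lborel_prod B_def by (rule nn_integral_indicator_ball_const)
  finally have "(\<integral>\<^sup>+w. indicator (ball z r) w * ennreal (M - u w) \<partial>lebesgue)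
      \<le> ennreal (measure lborel (ball z r) * (M - u z))"
    by (simp add: nn_integral_completion B_def c_def z)
  then show "ereal (u z) \<le> ball_average (\<lambda>z. ereal (u z)) z r"
    using v_meas M \<open>0 < r\<close> \<open>0 \<le> M\<close>
    by (subst submean_iff_nn_integral[where M = M]) (auto simp: v_def[abs_def] B_def measurable_completion)
qed

section \<open>Separately subharmonic and harmonic functions\<close>

theorem mainTheorem5:
  fixes \<Omega> :: "((real ^ 'm) \<times> (real ^ 'n)) set"
    and u :: "(real ^ 'm) \<times> (real ^ 'n) \<Rightarrow> real"
  assumes "CARD('m) \<ge> 2" and "CARD('n) \<ge> 2"
    and "open \<Omega>" and "connected \<Omega>" and "\<Omega> \<noteq> {}"
    and "\<And>y. nearly_subharmonic_on {x. (x, y) \<in> \<Omega>} (\<lambda>x. ereal (u (x, y)))"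
    and "AE y in lebesgue. subharmonic_on {x. (x, y) \<in> \<Omega>} (\<lambda>x. ereal (u (x, y)))"
    and "\<And>x. harmonic_on {y. (x, y) \<in> \<Omega>} (\<lambda>y. u (x, y))"
    and "\<exists>\<phi>. L1_loc \<Omega> \<phi> \<and> (\<forall>z\<in>\<Omega>. 0 \<le> \<phi> z) \<and> (\<forall>z\<in>\<Omega>. - \<phi> z \<le> u z)"
  shows "subharmonic_on \<Omega> (\<lambda>z. ereal (u z))"
proof -
  have sub_x: "\<And>y. nearly_subharmonic_on {x. (x, y) \<in> \<Omega>} (\<lambda>x. ereal (u (x, y)))"
    and usc_x: "AE y in lebesgue. usc_on {x. (x, y) \<in> \<Omega>} (\<lambda>x. ereal (u (x, y)))"
    and harm_y: "\<And>x. harmonic_on {y. (x, y) \<in> \<Omega>} (\<lambda>y. u (x, y))"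
    using assms(6-8) by (auto simp: subharmonic_on_def elim: eventually_mono)
  obtain \<phi> where \<phi>: "L1_loc \<Omega> \<phi>" "\<And>z. z \<in> \<Omega> \<Longrightarrow> - \<phi> z \<le> u z" using assms(9) by blast
  have usc: "usc_on \<Omega> (\<lambda>z. ereal (u z))"
    by (rule usc_on_if_usc_harmonic_slices[OF \<open>open \<Omega>\<close> usc_x harm_y
          nearly_subharmonic_harmonic_slices_locally_bounded_above[OF \<open>open \<Omega>\<close> sub_x harm_y \<phi>]])
  have "submean_on \<Omega> (\<lambda>z. ereal (u z))"
    using sub_x
    by (intro submean_on_if_submean_harmonic_slices[OF \<open>open \<Omega>\<close> usc _ harm_y])
       (simp add: nearly_subharmonic_on_def)
  with usc show ?thesis by (simp add: subharmonic_on_def)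
qed

end
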